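(* For $n$ large enough, $P_1$ can win each of the following games using a constant number of moves: 1. $R(K_n\sqcup K_n, K_{2,3})$; 2. $R(K_n, C_\ell)$, for any $\ell\ge 3$. Explicitly: (1) there exist constants $c$ and $n_0$ such that for every $n\ge n_0$, $P_1$ has a strategy in the game $R(K_n\sqcup K_n,K_{2,3})$ which, against every play of $P_2$, wins within at most $c$ of $P_1$'s moves; and (2) for every integer $\ell\ge 3$ there exist constants $c_\ell$ and $n_\ell$ such that for every $n\ge n_\ell$, $P_1$ has a strategy in the game $R(K_n,C_\ell)$ which, against every play of $P_2$, wins within at most $c_\ell$ of $P_1$'s moves.
   Context: **The strong Ramsey game.** Given a graph $\mathcal{B}$ (the board) and a graph $H$ (the target graph), the strong Ramsey game $R(\mathcal{B},H)$ is the two-player perfect-information game in which players $P_1$ and $P_2$ alternately claim one previously unclaimed edge of $\mathcal{B}$, with $P_1$ moving first. The first player whose set of claimed edges contains a (not necessarily induced) subgraph isomorphic to $H$ wins. If neither player ever achieves this, the game is a draw. **Graphs.** $K_n$ is the complete graph on $n$ vertices, $K_n\sqcup K_n$ is the disjoint union of two copies of $K_n$, $K_{2,3}$ is the complete bipartite graph with parts of sizes $2$ and $3$, and $C_\ell$ is the cycle of length $\ell$. *)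

theory Defs
  imports Main
begin

record 'a graph =
  verts :: "'a set"
  edges :: "'a set set"

definition simple_graph :: "'a graph \<Rightarrow> bool" where
  "simple_graph G \<longleftrightarrow> (\<forall>e\<in>edges G. e \<subseteq> verts G \<and> card e = 2)"

definition subgraph :: "'a graph \<Rightarrow> 'a graph \<Rightarrow> bool" where
  "subgraph G G' \<longleftrightarrow> simple_graph G \<and> verts G \<subseteq> verts G' \<and> edges G \<subseteq> edges G'"

definition isomorphic :: "'a graph \<Rightarrow> 'b graph \<Rightarrow> bool" where
  "isomorphic G H \<longleftrightarrow>
     (\<exists>f. bij_betw f (verts G) (verts H) \<and> (\<lambda>e. f ` e) ` edges G = edges H)"

definition complete_graph :: "nat \<Rightarrow> nat graph" where
  "complete_graph n = \<lparr>verts = {..<n}, edges = {e. e \<subseteq> {..<n} \<and> card e = 2}\<rparr>"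

definition disjoint_union :: "'a graph \<Rightarrow> 'b graph \<Rightarrow> ('a + 'b) graph" where
  "disjoint_union G H =
     \<lparr>verts = Inl ` verts G \<union> Inr ` verts H,
      edges = (\<lambda>e. Inl ` e) ` edges G \<union> (\<lambda>e. Inr ` e) ` edges H\<rparr>"

definition complete_bipartite :: "nat \<Rightarrow> nat \<Rightarrow> (nat + nat) graph" where
  "complete_bipartite m n =
     \<lparr>verts = Inl ` {..<m} \<union> Inr ` {..<n},
      edges = {{Inl i, Inr j} | i j. i < m \<and> j < n}\<rparr>"

(* A cycle, as a simple graph, only for l \<ge> 3. *)
definition cycle_graph :: "nat \<Rightarrow> nat graph" where
  "cycle_graph l = \<lparr>verts = {..<l}, edges = {{i, Suc i mod l} | i. i < l}\<rparr>"

(* A history lists the claimed edges in order of play; P1 makes the moves with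
   even index (starting with index 0), P2 those with odd index. *)

definition P1_edges :: "'e list \<Rightarrow> 'e set" where
  "P1_edges h = {h ! i | i. i < length h \<and> even i}"

definition P2_edges :: "'e list \<Rightarrow> 'e set" where
  "P2_edges h = {h ! i | i. i < length h \<and> odd i}"

definition has_target :: "'a graph \<Rightarrow> 'b graph \<Rightarrow> 'a set set \<Rightarrow> bool" where
  "has_target B H F \<longleftrightarrow>
     (\<exists>G. subgraph G \<lparr>verts = verts B, edges = F\<rparr> \<and> isomorphic G H)"

definition game_over :: "'a graph \<Rightarrow> 'b graph \<Rightarrow> 'a set list \<Rightarrow> bool" where
  "game_over B H h \<longleftrightarrow>
     has_target B H (P1_edges h) \<or> has_target B H (P2_edges h) \<or> edges B \<subseteq> set h"

(* A possibly unfinished play. No move is made once the game is over, so at most the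
   last move completes a copy of the target, and a player owning one was the first. *)
definition legal_play :: "'a graph \<Rightarrow> 'b graph \<Rightarrow> 'a set list \<Rightarrow> bool" where
  "legal_play B H h \<longleftrightarrow>
     distinct h \<and> set h \<subseteq> edges B \<and> (\<forall>k<length h. \<not> game_over B H (take k h))"

(* A strategy for P1 maps the history to the next edge to be claimed. *)
definition follows_P1 :: "('e list \<Rightarrow> 'e) \<Rightarrow> 'e list \<Rightarrow> bool" where
  "follows_P1 \<sigma> h \<longleftrightarrow> (\<forall>i<length h. even i \<longrightarrow> h ! i = \<sigma> (take i h))"

definition P1_strategy :: "'a graph \<Rightarrow> 'b graph \<Rightarrow> ('a set list \<Rightarrow> 'a set) \<Rightarrow> bool" where
  "P1_strategy B H \<sigma> \<longleftrightarrow>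
     (\<forall>h. legal_play B H h \<and> follows_P1 \<sigma> h \<and> even (length h) \<and> \<not> game_over B H h
          \<longrightarrow> \<sigma> h \<in> edges B - set h)"

(* Bounding the number of P1's moves in unfinished plays too excludes infinite plays,
   so the definition is also meaningful on an infinite board. *)
definition P1_wins_within :: "nat \<Rightarrow> 'a graph \<Rightarrow> 'b graph \<Rightarrow> bool" where
  "P1_wins_within c B H \<longleftrightarrow>
     (\<exists>\<sigma>. P1_strategy B H \<sigma> \<and>
        (\<forall>h. legal_play B H h \<and> follows_P1 \<sigma> h \<longrightarrow>
             card (P1_edges h) \<le> c \<and>
             (game_over B H h \<longrightarrow> has_target B H (P1_edges h))))"

end

theory Submission
  imports Defs
begin

text \<open>
On a large complete board P1 always finds vertices that no edge has touched yet, and both games are won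
by threats whose forced replies are edges to such new vertices and therefore nearly useless for P2.
It suffices to show that the empty position is won for P1 within a fixed number of moves, in the sense
of the recursive predicate \<open>forced_win\<close>, since choosing a winning move at every turn is then a winning
strategy (\<open>P1_wins_within_if_forced_win\<close>).

For \<open>C\<^sub>l\<close>, P1 builds a path with \<open>l - 2\<close> edges, always towards new vertices. While doing so P1
maintains that P2 has no path with the same number of edges from one end \<open>x0\<close> of P1's path
(\<open>grow_path\<close>): P2 cannot attach its newest edge to the new end and also use all its edges on a path from
the old end. Two prolongations of the path at the other end then force P2 to play two pendant edges at
\<open>x0\<close>, and a double threat follows. P2 could win in the meantime only by closing a cycle through one of
its pendant edges, and this needs a path with \<open>l - 2\<close> edges from \<open>x0\<close> (\<open>endgame\<close>).

For \<open>K\<^sub>2\<^sub>,\<^sub>3\<close>, a player who lacks one edge owns a 4-cycle with a pendant edge. Hence the game is about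
4-cycles. If P1 is to move and owns a 4-cycle with an additional edge, then P1 forces a sequence of
replies that are all pendant edges at one vertex \<open>m\<close> of P1's 4-cycle. They create no 4-cycle of P2, and
no threat of P2 either if \<open>m\<close> lies on none of P2's 4-cycles; so P1 wins unless P2 has a threat already or
owns 4-cycles through both of the vertices that could play the role of \<open>m\<close> (\<open>attack\<close>). To get there,
P1 makes a star with three leaves and joins one leaf to a further vertex \<open>w\<close>. There are two ways to
complete a 4-cycle and P2 can prevent only one (\<open>spider\<close>). At that time P2 has three edges from the
opening, one edge at \<open>w\<close>, and one arbitrary edge. It remains to choose \<open>w\<close> and the leaf joined to it so
that these five edges do not stop the attack. With a new vertex \<open>w\<close> this is possible unless the three
edges form a path that P2 could still close and that contains two leaves (\<open>star_closed_paths\<close>,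
\<open>spider_untouched\<close>). Since P1 arranges that P2's first edge contains no leaf, only two kinds of such
paths occur. If the two leaves are at one end of the path, P1 takes its other end for \<open>w\<close>
(\<open>path_from_two_leaves\<close>). If they are the two ends, P1 joins them. Then P2's path
can no longer be closed, and P1 can afford to get its 4-cycle one move later, should P2 delay it
(\<open>bridge\<close>).
\<close>

section \<open>Winning positions and strategies\<close>

text \<open>\<open>P\<close> and \<open>Q\<close> are the edges of the two players, with P1 to move, and \<open>T\<close> recognises the edge sets that
contain the target. The clause that some edge is left after P1's move excludes a draw on an
exhausted board.\<close>
primrec forced_win :: "'e set \<Rightarrow> ('e set \<Rightarrow> bool) \<Rightarrow> nat \<Rightarrow> 'e set \<Rightarrow> 'e set \<Rightarrow> bool" where
  "forced_win E T 0 P Q \<longleftrightarrow> False"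
| "forced_win E T (Suc k) P Q \<longleftrightarrow>
     (\<exists>e \<in> E - (P \<union> Q). T (insert e P) \<or>
        (E - (insert e P \<union> Q) \<noteq> {} \<and>
         (\<forall>f \<in> E - (insert e P \<union> Q).
            \<not> T (insert f Q) \<and> forced_win E T k (insert e P) (insert f Q))))"

text \<open>The first move of one unfolding of \<open>forced_win\<close>, isolated so that a strategy can be built by
choosing such a move at every history.\<close>
definition winning_move :: "'e set \<Rightarrow> ('e set \<Rightarrow> bool) \<Rightarrow> nat \<Rightarrow> 'e set \<Rightarrow> 'e set \<Rightarrow> 'e \<Rightarrow> bool" where
  "winning_move E T k P Q e \<longleftrightarrow> e \<in> E - (P \<union> Q) \<and> (T (insert e P) \<or>
        (E - (insert e P \<union> Q) \<noteq> {} \<and>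
         (\<forall>f \<in> E - (insert e P \<union> Q).
            \<not> T (insert f Q) \<and> forced_win E T k (insert e P) (insert f Q))))"

lemma forced_win_Suc_iff: "forced_win E T (Suc k) P Q \<longleftrightarrow> (\<exists>e. winning_move E T k P Q e)"
  by (auto simp: winning_move_def)

lemma forced_win_Suc: "forced_win E T k P Q \<Longrightarrow> forced_win E T (Suc k) P Q"
proof (induction k arbitrary: P Q)
  case 0
  then show ?case by simp
next
  case (Suc k)
  from Suc.prems obtain e where e: "winning_move E T k P Q e"
    unfolding forced_win_Suc_iff by blast
  have "winning_move E T (Suc k) P Q e"
    using e Suc.IH unfolding winning_move_def by blast
  then show ?case unfolding forced_win_Suc_iff[of E T "Suc k"] by blast
qed

lemma forced_win_mono:
  assumes "forced_win E T k P Q" and "k \<le> k'"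
  shows "forced_win E T k' P Q"
  using assms(2,1) by (induction k' rule: dec_induct) (blast intro: forced_win_Suc)+

text \<open>The target is given through embeddings of a graph, the arguments below through explicit edge
patterns; this lemma exchanges one for the other.\<close>
lemma forced_win_cong:
  assumes "\<And>F. F \<subseteq> E \<Longrightarrow> T F = T' F" "P \<subseteq> E" "Q \<subseteq> E"
  shows "forced_win E T k P Q = forced_win E T' k P Q"
  using assms(2,3)
proof (induction k arbitrary: P Q)
  case 0
  then show ?case by simp
next
  case (Suc k)
  have "winning_move E T k P Q e = winning_move E T' k P Q e" for e
  proof (cases "e \<in> E")
    case True
    then have "T (insert e P) = T' (insert e P)" using assms(1) Suc.prems by simp
    moreover have "(\<not> T (insert f Q) \<and> forced_win E T k (insert e P) (insert f Q)) =
      (\<not> T' (insert f Q) \<and> forced_win E T' k (insert e P) (insert f Q))" if "f \<in> E" for f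
      using assms(1)[of "insert f Q"] Suc.IH[of "insert e P" "insert f Q"] Suc.prems True that by simp
    ultimately show ?thesis unfolding winning_move_def by blast
  qed (simp add: winning_move_def)
  then show ?case unfolding forced_win_Suc_iff by blast
qed

lemma P1_edges_snoc:
  "P1_edges (h @ [e]) = (if even (length h) then insert e (P1_edges h) else P1_edges h)"
proof -
  have "P1_edges (h @ [e]) = {(h @ [e]) ! i | i. i < length h \<and> even i}
      \<union> {(h @ [e]) ! i | i. i = length h \<and> even i}"
    unfolding P1_edges_def by (auto simp only: length_append_singleton less_Suc_eq)
  also have "{(h @ [e]) ! i | i. i < length h \<and> even i} = P1_edges h"
    unfolding P1_edges_def by (intro Collect_cong ex_cong1) (auto simp: nth_append)
  finally show ?thesis by auto
qed

lemma P2_edges_snoc: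
  "P2_edges (h @ [e]) = (if even (length h) then P2_edges h else insert e (P2_edges h))"
proof -
  have "P2_edges (h @ [e]) = {(h @ [e]) ! i | i. i < length h \<and> odd i}
      \<union> {(h @ [e]) ! i | i. i = length h \<and> odd i}"
    unfolding P2_edges_def by (auto simp only: length_append_singleton less_Suc_eq)
  also have "{(h @ [e]) ! i | i. i < length h \<and> odd i} = P2_edges h"
    unfolding P2_edges_def by (intro Collect_cong ex_cong1) (auto simp: nth_append)
  finally show ?thesis by auto
qed

lemma P1_P2_edges: "P1_edges h \<union> P2_edges h = set h"
  unfolding P1_edges_def P2_edges_def by (auto simp: set_conv_nth)

lemma card_P1_edges: "card (P1_edges h) \<le> (length h + 1) div 2"
proof (induction h rule: rev_induct)
  case Nil
  then show ?case by (simp add: P1_edges_def)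
next
  case (snoc e h)
  have "card (insert e (P1_edges h)) \<le> Suc (card (P1_edges h))" by (rule card_insert_le_m1) auto
  with snoc show ?case by (auto simp: P1_edges_snoc elim!: evenE)
qed

lemma even_length_induct [consumes 1, case_names Nil two]:
  assumes "even (length h)" and "P []" and "\<And>h e f. even (length h) \<Longrightarrow> P h \<Longrightarrow> P (h @ [e, f])"
  shows "P h"
  using assms(1)
proof (induction "length h" arbitrary: h rule: less_induct)
  case less
  show ?case
  proof (cases h rule: rev_cases)
    case Nil
    with assms(2) show ?thesis by simp
  next
    case (snoc h' f)
    with less.prems have "odd (length h')" by simp
    then obtain g e where g: "h' = g @ [e]" by (cases h' rule: rev_cases) auto
    have "P g" using less.hyps[of g] less.prems snoc g by simp
    then show ?thesis using assms(3)[of g e f] less.prems snoc g by simp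
  qed
qed

lemma legal_play_appendD:
  assumes "legal_play B H (h @ g)"
  shows "legal_play B H h"
proof -
  have "\<not> game_over B H (take k h)" if "k < length h" for k
    using assms that by (fastforce simp: legal_play_def dest!: spec[of _ k])
  then show ?thesis using assms by (simp add: legal_play_def)
qed

lemma legal_play_snoc_not_over: "legal_play B H (h @ e # g) \<Longrightarrow> \<not> game_over B H h"
  unfolding legal_play_def by (auto dest!: spec[of _ "length h"])

lemma follows_P1_appendD:
  assumes "follows_P1 \<sigma> (h @ g)"
  shows "follows_P1 \<sigma> h"
  unfolding follows_P1_def
proof (intro allI impI)
  fix i assume "i < length h" "even i"
  then show "h ! i = \<sigma> (take i h)"
    using assms by (auto simp: follows_P1_def nth_append dest!: spec[of _ i])
qed

lemma follows_P1_snocD: "follows_P1 \<sigma> (h @ e # g) \<Longrightarrow> even (length h) \<Longrightarrow> e = \<sigma> h"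
  unfolding follows_P1_def by (auto dest!: spec[of _ "length h"] simp: nth_append)

text \<open>The strategy plays, after \<open>i\<close> rounds, some winning move for the bound \<open>k - Suc i\<close>. Along every play
that follows it, \<open>forced_win\<close> then holds with bound \<open>k - i\<close> whenever P1 is to move; since play stops
as soon as P1 owns the target, only the second disjunct of \<open>winning_move\<close> concerns the histories
that are continued.\<close>
theorem P1_wins_within_if_forced_win:
  assumes "forced_win (edges B) (has_target B H) k {} {}"
  shows "P1_wins_within k B H"
proof -
  let ?E = "edges B" and ?T = "has_target B H"
  define good where "good h = winning_move ?E ?T (k - Suc (length h div 2)) (P1_edges h) (P2_edges h)" for h
  define \<sigma> where "\<sigma> h = (SOME e. good h e)" for h
  have \<sigma>_good: "length h div 2 < k \<and> good h (\<sigma> h)"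
    if "forced_win ?E ?T (k - length h div 2) (P1_edges h) (P2_edges h)" for h
  proof -
    from that have less: "length h div 2 < k" by (cases "k - length h div 2") auto
    then have "k - length h div 2 = Suc (k - Suc (length h div 2))" by simp
    with that have "\<exists>e. good h e" unfolding good_def using forced_win_Suc_iff by metis
    then show ?thesis using less unfolding \<sigma>_def by (auto intro: someI_ex)
  qed
  have inv: "legal_play B H h \<Longrightarrow> follows_P1 \<sigma> h \<Longrightarrow>
      forced_win ?E ?T (k - length h div 2) (P1_edges h) (P2_edges h)
      \<and> (?T (P2_edges h) \<longrightarrow> ?T (P1_edges h))" if "even (length h)" for h
    using that
  proof (induction h rule: even_length_induct)
    case Nil
    then show ?case using assms by (simp add: P1_edges_def P2_edges_def)
  next
    case (two h e f)
    have legal: "legal_play B H h" "\<not> game_over B H (h @ [e])"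
      using legal_play_appendD[of B H h "[e, f]"] legal_play_snoc_not_over[of B H "h @ [e]" f "[]"]
        two.prems(1) by simp_all
    have fol: "follows_P1 \<sigma> h" "e = \<sigma> h"
      using follows_P1_appendD[of \<sigma> h "[e, f]"] follows_P1_snocD[of \<sigma> h e "[f]"] two.prems(2) two.hyps
      by blast+
    have g: "good h e" "length h div 2 < k" using \<sigma>_good[of h] two.IH[OF legal(1) fol(1)] fol(2) by simp_all
    have "\<not> ?T (insert e (P1_edges h))"
      using legal(2) two.hyps by (auto simp: game_over_def P1_edges_snoc)
    moreover have "f \<in> ?E - (insert e (P1_edges h) \<union> P2_edges h)"
      using two.prems(1) P1_P2_edges[of h] unfolding legal_play_def by auto
    ultimately have "\<not> ?T (insert f (P2_edges h))"
      "forced_win ?E ?T (k - Suc (length h div 2)) (insert e (P1_edges h)) (insert f (P2_edges h))"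
      using g(1) unfolding good_def winning_move_def by auto
    moreover have "P1_edges (h @ [e, f]) = insert e (P1_edges h)"
       "P2_edges (h @ [e, f]) = insert f (P2_edges h)"
      using two.hyps P1_edges_snoc[of "h @ [e]" f] P1_edges_snoc[of h e]
        P2_edges_snoc[of "h @ [e]" f] P2_edges_snoc[of h e] by simp_all
    ultimately show ?case using two.hyps by simp
  qed
  have "P1_strategy B H \<sigma>"
    unfolding P1_strategy_def
  proof (intro allI impI)
    fix h assume h: "legal_play B H h \<and> follows_P1 \<sigma> h \<and> even (length h) \<and> \<not> game_over B H h"
    then have "good h (\<sigma> h)" using inv \<sigma>_good by blast
    then show "\<sigma> h \<in> ?E - set h" using P1_P2_edges[of h] by (auto simp: good_def winning_move_def)
  qed
  moreover have "card (P1_edges h) \<le> k \<and> (game_over B H h \<longrightarrow> ?T (P1_edges h))"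
    if h: "legal_play B H h" "follows_P1 \<sigma> h" for h
  proof (cases "even (length h)")
    case True
    note i = inv[OF True h]
    then have g: "good h (\<sigma> h)" "length h div 2 < k" using \<sigma>_good[of h] by simp_all
    have "card (P1_edges h) \<le> k" using card_P1_edges[of h] g(2) True by (auto elim!: evenE)
    moreover have "\<not> ?E \<subseteq> set h" using g(1) P1_P2_edges[of h] by (auto simp: good_def winning_move_def)
    ultimately show ?thesis using i by (auto simp: game_over_def)
  next
    case False
    then obtain g e where ge: "h = g @ [e]" by (cases h rule: rev_cases) auto
    with False have ev: "even (length g)" by simp
    have lg: "legal_play B H g" "follows_P1 \<sigma> g" "\<not> game_over B H g" "e = \<sigma> g"
      using h ev legal_play_appendD[of B H g "[e]"] follows_P1_appendD[of \<sigma> g "[e]"]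
        legal_play_snoc_not_over[of B H g e "[]"] follows_P1_snocD[of \<sigma> g e "[]"]
      unfolding ge by blast+
    have gd: "good g e" "length g div 2 < k" using \<sigma>_good[of g] inv[OF ev lg(1,2)] lg(4) by simp_all
    have "card (P1_edges h) \<le> k" using card_P1_edges[of h] gd(2) ge ev by (auto elim!: evenE)
    moreover have "P1_edges h = insert e (P1_edges g)" "P2_edges h = P2_edges g"
      using ge ev by (auto simp: P1_edges_snoc P2_edges_snoc)
    moreover have "\<not> ?T (P2_edges g)" using lg(3) by (simp add: game_over_def)
    moreover have "?T (insert e (P1_edges g)) \<or> \<not> ?E \<subseteq> set h"
      using gd(1) ge P1_P2_edges[of g] by (auto simp: good_def winning_move_def)
    ultimately show ?thesis by (auto simp: game_over_def)
  qed
  ultimately show ?thesis unfolding P1_wins_within_def by blast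
qed

section \<open>Boards with room for new vertices\<close>

lemma card_Union_doubletons_le:
  assumes "finite F" "\<And>e. e \<in> F \<Longrightarrow> card e = 2"
  shows "card (\<Union>F) \<le> 2 * card F"
proof -
  have "card (\<Union>F) \<le> (\<Sum>e\<in>F. card e)" by (rule card_Union_le_sum_card)
  also have "\<dots> = 2 * card F" using assms by simp
  finally show ?thesis .
qed

text \<open>\<open>V\<close> is the vertex set of a complete connected component of the board, which may have edges elsewhere.
P1 plays inside \<open>V\<close> only, and every vertex joined to \<open>V\<close> by an edge of P2 is again in \<open>V\<close>.\<close>
locale board =
  fixes E :: "'a set set" and V :: "'a set"
  assumes card_edge: "e \<in> E \<Longrightarrow> card e = 2"
    and edge_in_V: "\<lbrakk>x \<in> V; y \<in> V; x \<noteq> y\<rbrakk> \<Longrightarrow> {x, y} \<in> E"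
    and edge_closed: "\<lbrakk>{x, y} \<in> E; x \<in> V\<rbrakk> \<Longrightarrow> y \<in> V"
begin

text \<open>The inequality reserves vertices: a round adds two edges and hence at most four touched vertices, so
that after \<open>j\<close> further rounds at least two vertices of \<open>V\<close> are still untouched.\<close>
definition position :: "nat \<Rightarrow> 'a set set \<Rightarrow> 'a set set \<Rightarrow> bool" where
  "position j P Q \<longleftrightarrow> P \<subseteq> E \<and> Q \<subseteq> E \<and> P \<inter> Q = {} \<and> finite P \<and> finite Q \<and>
     2 * (card P + card Q) + 4 * j + 2 \<le> card V"

lemma position_weaken: "position (i + j) P Q \<Longrightarrow> position j P Q"
  unfolding position_def by auto

lemma fresh_vertex:
  assumes "F \<subseteq> E" "finite F" "2 * card F < card V"
  obtains d where "d \<in> V" "\<And>e. e \<in> F \<Longrightarrow> d \<notin> e"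
proof -
  have "finite (\<Union>F)" using assms card_edge by (metis card_ge_0_finite finite_Union subsetD zero_less_numeral)
  then have "\<not> V \<subseteq> \<Union>F"
    using card_Union_doubletons_le[of F] assms card_edge card_mono[of "\<Union>F" V] by fastforce
  then show ?thesis using that by blast
qed

lemma position_fresh:
  assumes "position j P Q"
  obtains d where "d \<in> V" "\<And>e. e \<in> P \<Longrightarrow> d \<notin> e" "\<And>e. e \<in> Q \<Longrightarrow> d \<notin> e"
proof -
  have "card (P \<union> Q) \<le> card P + card Q" by (rule card_Un_le)
  then have "2 * card (P \<union> Q) < card V" using assms by (auto simp: position_def)
  then obtain d where "d \<in> V" "\<And>e. e \<in> P \<union> Q \<Longrightarrow> d \<notin> e"
    using fresh_vertex[of "P \<union> Q"] assms unfolding position_def by blast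
  then show ?thesis using that by blast
qed

lemma position_move:
  assumes "position (Suc j) P Q" "e \<in> E" "f \<in> E" "e \<notin> Q" "f \<notin> P" "f \<noteq> e"
  shows "position j (insert e P) (insert f Q)"
proof -
  have "card (insert e P) \<le> card P + 1" "card (insert f Q) \<le> card Q + 1"
    using card_insert_le_m1[of "card P + 1" P e] card_insert_le_m1[of "card Q + 1" Q f] by auto
  with assms show ?thesis by (auto simp: position_def)
qed

lemma position_free_edge:
  assumes "position (Suc j) P Q" "e \<in> E"
  shows "E - (insert e P \<union> Q) \<noteq> {}"
proof -
  let ?F = "insert e (P \<union> Q)"
  have "card ?F \<le> card (P \<union> Q) + 1" "card (P \<union> Q) \<le> card P + card Q"
    using card_insert_le_m1[of "card (P \<union> Q) + 1" "P \<union> Q" e] card_Un_le by auto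
  then have c: "2 * card ?F + 2 < card V" and fin: "finite ?F" and sub: "?F \<subseteq> E"
    using assms by (auto simp: position_def)
  obtain d where d: "d \<in> V" "\<And>e. e \<in> ?F \<Longrightarrow> d \<notin> e"
    using fresh_vertex[of ?F] c fin sub by auto
  have "finite (\<Union>?F)" using fin sub card_edge
    by (metis card_ge_0_finite finite_Union subsetD zero_less_numeral)
  moreover have "V \<noteq> {d}" using c by auto
  ultimately obtain d' where "d' \<in> V" "d' \<noteq> d" using d(1) by blast
  then have "{d, d'} \<in> E - ?F" using d edge_in_V by blast
  then show ?thesis by auto
qed

end

locale board_game = board E V for E :: "'a set set" and V +
  fixes T :: "'a set set \<Rightarrow> bool"
begin

abbreviation wins :: "nat \<Rightarrow> 'a set set \<Rightarrow> 'a set set \<Rightarrow> bool" where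
  "wins \<equiv> forced_win E T"

lemma wins_finish:
  assumes "e \<in> E" "e \<notin> P" "e \<notin> Q" "T (insert e P)" "k \<noteq> 0"
  shows "wins k P Q"
  using assms by (cases k) auto

lemma wins_step:
  assumes "position (Suc j) P Q" "e \<in> E" "e \<notin> P" "e \<notin> Q"
    and "\<And>f. \<lbrakk>f \<in> E; f \<notin> P; f \<notin> Q; f \<noteq> e; position j (insert e P) (insert f Q)\<rbrakk>
      \<Longrightarrow> \<not> T (insert f Q) \<and> wins k (insert e P) (insert f Q)"
  shows "wins (Suc k) P Q"
proof -
  have "\<not> T (insert f Q) \<and> wins k (insert e P) (insert f Q)" if "f \<in> E - (insert e P \<union> Q)" for f
    using that assms(5)[of f] position_move[OF assms(1,2), of f] assms(4) by simp
  then show ?thesis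
    using assms(2-4) position_free_edge[OF assms(1,2)] by auto
qed

text \<open>P1 plays \<open>e\<close> and threatens \<open>g\<close>; unless P2 can win at once, the reply has to be \<open>g\<close>.\<close>
lemma wins_force:
  assumes "position (Suc j) P Q" "e \<in> E" "e \<notin> P" "e \<notin> Q"
    and "g \<in> E" "g \<notin> P" "g \<notin> Q" "g \<noteq> e" "T (insert g (insert e P))"
    and "\<And>f. \<lbrakk>f \<in> E; f \<notin> P; f \<notin> Q; f \<noteq> e\<rbrakk> \<Longrightarrow> \<not> T (insert f Q)"
    and "k \<noteq> 0" and "position j (insert e P) (insert g Q) \<Longrightarrow> wins k (insert e P) (insert g Q)"
  shows "wins (Suc k) P Q"
proof (rule wins_step[OF assms(1-4)])
  fix f assume f: "f \<in> E" "f \<notin> P" "f \<notin> Q" "f \<noteq> e" "position j (insert e P) (insert f Q)"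
  show "\<not> T (insert f Q) \<and> wins k (insert e P) (insert f Q)"
  proof (cases "f = g")
    case True
    with f assms(10,12) show ?thesis by simp
  next
    case False
    then have "wins k (insert e P) (insert f Q)"
      using assms(5-9,11) by (intro wins_finish[of g]) auto
    with f assms(10) show ?thesis by simp
  qed
qed

lemma wins_double_threat:
  assumes "position (Suc j) P Q" "e \<in> E" "e \<notin> P" "e \<notin> Q"
    and "g \<in> E" "g \<notin> P" "g \<notin> Q" "g \<noteq> e" "T (insert g (insert e P))"
    and "g' \<in> E" "g' \<notin> P" "g' \<notin> Q" "g' \<noteq> e" "T (insert g' (insert e P))" "g \<noteq> g'"
    and "\<And>f. \<lbrakk>f \<in> E; f \<notin> P; f \<notin> Q; f \<noteq> e\<rbrakk> \<Longrightarrow> \<not> T (insert f Q)"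
  shows "wins 2 P Q"
  unfolding numeral_2_eq_2
proof (rule wins_force[OF assms(1-9) assms(16)])
  assume "position j (insert e P) (insert g Q)"
  show "wins (Suc 0) (insert e P) (insert g Q)"
    using assms(10-15) by (intro wins_finish[of g']) auto
qed auto

end

section \<open>Threats in the game for \<open>K\<^sub>2\<^sub>,\<^sub>3\<close>\<close>

lemma edge_commute: "{x, y} = {y, x}"
  by (rule insert_commute)

definition k23 :: "'a set set \<Rightarrow> bool" where
  "k23 F \<longleftrightarrow> (\<exists>u v a b c. distinct [u, v, a, b, c] \<and>
     {u, a} \<in> F \<and> {u, b} \<in> F \<and> {u, c} \<in> F \<and> {v, a} \<in> F \<and> {v, b} \<in> F \<and> {v, c} \<in> F)"

definition c4 :: "'a set set \<Rightarrow> 'a \<Rightarrow> 'a \<Rightarrow> 'a \<Rightarrow> 'a \<Rightarrow> bool" where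
  "c4 F p q r s \<longleftrightarrow> distinct [p, q, r, s] \<and>
     {p, q} \<in> F \<and> {q, r} \<in> F \<and> {r, s} \<in> F \<and> {s, p} \<in> F"

definition on_c4 :: "'a set set \<Rightarrow> 'a \<Rightarrow> bool" where
  "on_c4 F p \<longleftrightarrow> (\<exists>q r s. c4 F p q r s)"

text \<open>\<open>K\<^sub>2\<^sub>,\<^sub>3\<close> without one edge is a 4-cycle \<open>p q r s\<close> with a pendant edge \<open>{p, t}\<close>, and \<open>{r, t}\<close> is the missing
edge. So P2, with edges \<open>Q\<close>, has no threat iff P1 has already taken all these missing edges.\<close>
definition safe :: "'a set set \<Rightarrow> 'a set set \<Rightarrow> bool" where
  "safe P Q \<longleftrightarrow> (\<forall>p q r s t. c4 Q p q r s \<longrightarrow> {p, t} \<in> Q \<longrightarrow> t \<notin> {p, q, r, s} \<longrightarrow> {r, t} \<in> P)"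

lemma safeD:
  "\<lbrakk>safe P Q; c4 Q p q r s; {p, t} \<in> Q; t \<notin> {p, q, r, s}\<rbrakk> \<Longrightarrow> {r, t} \<in> P"
  unfolding safe_def by simp

lemma k23_E:
  assumes "k23 F"
  obtains u v a b c where "distinct [u, v, a, b, c]"
    "{u, a} \<in> F" "{u, b} \<in> F" "{u, c} \<in> F" "{v, a} \<in> F" "{v, b} \<in> F" "{v, c} \<in> F"
  using assms unfolding k23_def by blast

lemma k23_I:
  assumes "distinct [u, v, a, b, c]"
    "{u, a} \<in> F" "{u, b} \<in> F" "{u, c} \<in> F" "{v, a} \<in> F" "{v, b} \<in> F" "{v, c} \<in> F"
  shows "k23 F"
  using assms unfolding k23_def by blast

lemma c4_I:
  assumes "distinct [p, q, r, s]" "{p, q} \<in> F" "{q, r} \<in> F" "{r, s} \<in> F" "{s, p} \<in> F"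
  shows "c4 F p q r s"
  using assms unfolding c4_def by blast

lemma safe_not_k23:
  assumes "safe P Q" "P \<inter> Q = {}"
  shows "\<not> k23 Q"
proof
  assume "k23 Q"
  then obtain u v a b c where d: "distinct [u, v, a, b, c]"
    and e: "{u, a} \<in> Q" "{u, b} \<in> Q" "{u, c} \<in> Q" "{v, a} \<in> Q" "{v, b} \<in> Q" "{v, c} \<in> Q"
    by (rule k23_E)
  have "c4 Q u a v b" using d e by (intro c4_I) (auto simp: edge_commute)
  moreover have "c \<notin> {u, a, v, b}" using d by auto
  ultimately have "{v, c} \<in> P" using safeD[OF assms(1)] e(3) by metis
  then show False using e(6) assms(2) by blast
qed

text \<open>By the symmetry between the two vertices of degree three and between the three others, whichever
of the six edges is the new one, its removal leaves the same graph.\<close>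
lemma k23_insertE:
  assumes "k23 (insert f Q)" "\<not> k23 Q"
  obtains p q r s t where "c4 Q p q r s" "{p, t} \<in> Q" "t \<notin> {p, q, r, s}" "f = {r, t}"
proof -
  note result = that
  obtain u v a b c where d: "distinct [u, v, a, b, c]"
    and e: "{u, a} \<in> insert f Q" "{u, b} \<in> insert f Q" "{u, c} \<in> insert f Q"
      "{v, a} \<in> insert f Q" "{v, b} \<in> insert f Q" "{v, c} \<in> insert f Q"
    using assms(1) by (rule k23_E)
  have key: thesis if *: "distinct [u', v', a', b', c']" "f = {v', c'}"
     "{u', a'} \<in> insert f Q" "{u', b'} \<in> insert f Q" "{u', c'} \<in> insert f Q"
     "{v', a'} \<in> insert f Q" "{v', b'} \<in> insert f Q" for u' v' a' b' c'
  proof (rule result)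
    have "{u', a'} \<noteq> f" "{u', b'} \<noteq> f" "{u', c'} \<noteq> f" "{v', a'} \<noteq> f" "{v', b'} \<noteq> f"
      using *(1,2) by (auto simp: doubleton_eq_iff)
    then have "{u', a'} \<in> Q" "{u', b'} \<in> Q" "{v', a'} \<in> Q" "{v', b'} \<in> Q" and c: "{u', c'} \<in> Q"
      using *(3-7) by simp_all
    then show "c4 Q u' a' v' b'" using *(1) by (intro c4_I) (auto simp: edge_commute)
    show "{u', c'} \<in> Q" by (rule c)
    show "c' \<notin> {u', a', v', b'}" using *(1) by auto
  qed (rule *(2))
  have "f \<in> {{u, a}, {u, b}, {u, c}, {v, a}, {v, b}, {v, c}}" (is "f \<in> ?K")
  proof (rule ccontr)
    assume "f \<notin> ?K"
    then have in_Q: "x \<in> Q" if "x \<in> insert f Q" "x \<in> ?K" for x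
      using that by (metis insertE)
    have "k23 Q"
      by (rule k23_I[OF d in_Q[OF e(1)] in_Q[OF e(2)] in_Q[OF e(3)]
            in_Q[OF e(4)] in_Q[OF e(5)] in_Q[OF e(6)]]) simp_all
    with assms(2) show False ..
  qed
  then show thesis
  proof (elim insertE emptyE)
    assume *: "f = {u, a}"
    show thesis by (rule key[OF _ * e(5) e(6) e(4) e(2) e(3)]) (use d in auto)
  next
    assume *: "f = {u, b}"
    show thesis by (rule key[OF _ * e(4) e(6) e(5) e(1) e(3)]) (use d in auto)
  next
    assume *: "f = {u, c}"
    show thesis by (rule key[OF _ * e(4) e(5) e(6) e(1) e(2)]) (use d in auto)
  next
    assume *: "f = {v, a}"
    show thesis by (rule key[OF _ * e(2) e(3) e(1) e(5) e(6)]) (use d in auto)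
  next
    assume *: "f = {v, b}"
    show thesis by (rule key[OF _ * e(1) e(3) e(2) e(4) e(6)]) (use d in auto)
  next
    assume *: "f = {v, c}"
    show thesis by (rule key[OF _ * e(1) e(2) e(3) e(4) e(5)]) (use d in auto)
  qed
qed

lemma safe_not_k23_insert:
  assumes "safe P Q" "P \<inter> Q = {}" "f \<notin> P"
  shows "\<not> k23 (insert f Q)"
proof
  assume "k23 (insert f Q)"
  then obtain p q r s t where "c4 Q p q r s" "{p, t} \<in> Q" "t \<notin> {p, q, r, s}" "f = {r, t}"
    using safe_not_k23[OF assms(1,2)] by (rule k23_insertE)
  then show False using safeD[OF assms(1)] assms(3) by blast
qed

lemma safe_mono: "safe P Q \<Longrightarrow> P \<subseteq> P' \<Longrightarrow> safe P' Q"
  unfolding safe_def by blast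

lemma c4_insert_pendant:
  assumes "c4 (insert {m, d} Q) p q r s" "\<And>e. e \<in> Q \<Longrightarrow> d \<notin> e"
  shows "c4 Q p q r s"
proof -
  have "d \<notin> {p, q, r, s}"
  proof
    assume "d \<in> {p, q, r, s}"
    then show False using assms by (auto simp: c4_def doubleton_eq_iff)
  qed
  then show ?thesis using assms(1) by (auto simp: c4_def)
qed

text \<open>The edge \<open>{m, d}\<close> to a new vertex \<open>d\<close> lies on no 4-cycle, and it is a pendant edge of a 4-cycle only if
\<open>m\<close> lies on one.\<close>
lemma safe_insert_pendant:
  assumes "safe P Q" "\<And>e. e \<in> Q \<Longrightarrow> d \<notin> e" "\<not> on_c4 Q m"
  shows "safe P (insert {m, d} Q)"
  unfolding safe_def
proof (intro allI impI)
  fix p q r s t assume a: "c4 (insert {m, d} Q) p q r s" "{p, t} \<in> insert {m, d} Q" "t \<notin> {p, q, r, s}"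
  have c: "c4 Q p q r s" using c4_insert_pendant[OF a(1) assms(2)] .
  then have "p \<noteq> m" using assms(3) by (auto simp: on_c4_def)
  moreover have "p \<noteq> d" using c assms(2)[of "{p, q}"] by (auto simp: c4_def)
  ultimately have "{p, t} \<in> Q" using a(2) by (auto simp: doubleton_eq_iff)
  then show "{r, t} \<in> P" by (rule safeD[OF assms(1) c _ a(3)])
qed

lemma not_on_c4_insert_pendant:
  "\<not> on_c4 Q m \<Longrightarrow> (\<And>e. e \<in> Q \<Longrightarrow> d \<notin> e) \<Longrightarrow> \<not> on_c4 (insert {m, d} Q) m"
  unfolding on_c4_def by (meson c4_insert_pendant)

locale k23_game = board_game E V k23 for E :: "'a set set" and V
begin

lemma safe_no_reply:
  "position j P Q \<Longrightarrow> safe P Q \<Longrightarrow> f \<notin> P \<Longrightarrow> \<not> k23 (insert f Q)"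
  using safe_not_k23_insert unfolding position_def by blast

text \<open>P1 owns the 4-cycle \<open>l u m w\<close>. Joining \<open>l\<close> to a new vertex \<open>d\<close> threatens \<open>{m, d}\<close>, which would give
\<open>K\<^sub>2\<^sub>,\<^sub>3\<close> with parts \<open>{l, m}\<close> and \<open>{u, w, d}\<close>. The forced reply \<open>{m, d}\<close> gives P2 nothing as long as \<open>m\<close> is on
no 4-cycle of P2, and this stays true, so the step can be repeated.\<close>
lemma threat_step:
  assumes pos: "position (Suc j) P Q" and safe: "safe P Q" and m: "\<not> on_c4 Q m"
    and V: "l \<in> V" "m \<in> V"
    and c4: "distinct [l, m, u, w]" "{l, u} \<in> P" "{l, w} \<in> P" "{m, u} \<in> P" "{m, w} \<in> P"
    and k: "k \<noteq> 0"
    and cont: "\<And>d. \<lbrakk>d \<in> V; \<And>e. e \<in> P \<Longrightarrow> d \<notin> e; \<And>e. e \<in> Q \<Longrightarrow> d \<notin> e;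
      position j (insert {l, d} P) (insert {m, d} Q);
      safe (insert {l, d} P) (insert {m, d} Q); \<not> on_c4 (insert {m, d} Q) m\<rbrakk>
      \<Longrightarrow> wins k (insert {l, d} P) (insert {m, d} Q)"
  shows "wins (Suc k) P Q"
proof -
  obtain d where d: "d \<in> V" "\<And>e. e \<in> P \<Longrightarrow> d \<notin> e" "\<And>e. e \<in> Q \<Longrightarrow> d \<notin> e"
    using position_fresh[OF pos] by blast
  have ne: "d \<noteq> l" "d \<noteq> m" "d \<noteq> u" "d \<noteq> w"
    using d(2)[OF c4(2)] d(2)[OF c4(5)] by auto
  have new: "{l, d} \<notin> P" "{l, d} \<notin> Q" "{m, d} \<notin> P" "{m, d} \<notin> Q"
    using d(2,3) by blast+
  show ?thesis
  proof (rule wins_force[OF pos, where e = "{l, d}" and g = "{m, d}"])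
    show "{l, d} \<in> E" "{m, d} \<in> E" using edge_in_V d(1) V ne by auto
    show "{m, d} \<noteq> {l, d}" using c4(1) ne by (auto simp: doubleton_eq_iff)
    show "k23 (insert {m, d} (insert {l, d} P))"
      by (rule k23_I[of l m u w d]) (use c4 ne in auto)
    show "\<not> k23 (insert f Q)" if "f \<notin> P" for f using safe_no_reply[OF pos safe that] .
    assume "position j (insert {l, d} P) (insert {m, d} Q)"
    then show "wins k (insert {l, d} P) (insert {m, d} Q)"
      using cont[of d] d safe_insert_pendant[OF safe d(3) m] not_on_c4_insert_pendant[OF m d(3)]
        safe_mono[of P _ "insert {l, d} P"] by blast
  qed (use new k in auto)
qed

text \<open>After \<open>{p, d1}\<close> the vertices \<open>p\<close> and \<open>l\<close> have the common neighbours \<open>u\<close> and \<open>d1\<close>, and either of \<open>d2\<close>, \<open>d3\<close>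
would be a third one.\<close>
lemma star_finish:
  assumes pos: "position (Suc j) P Q" and safe: "safe P Q"
    and d: "distinct [l, p, u, d1, d2, d3]" "{u, l} \<in> P" "{u, p} \<in> P"
      "{l, d1} \<in> P" "{l, d2} \<in> P" "{l, d3} \<in> P"
    and free: "{p, d1} \<in> E - (P \<union> Q)" "{p, d2} \<in> E - (P \<union> Q)" "{p, d3} \<in> E - (P \<union> Q)"
  shows "wins 2 P Q"
proof (rule wins_double_threat[OF pos, where e = "{p, d1}" and g = "{p, d2}" and g' = "{p, d3}"])
  show "k23 (insert {p, d2} (insert {p, d1} P))"
    by (rule k23_I[of p l u d1 d2]) (use d in \<open>auto simp: edge_commute\<close>)
  show "k23 (insert {p, d3} (insert {p, d1} P))"
    by (rule k23_I[of p l u d1 d3]) (use d in \<open>auto simp: edge_commute\<close>)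
  show "\<not> k23 (insert f Q)" if "f \<notin> P" for f using safe_no_reply[OF pos safe that] .
  show "{p, d2} \<noteq> {p, d1}" "{p, d3} \<noteq> {p, d1}" "{p, d2} \<noteq> {p, d3}"
    using d(1) by (auto simp: doubleton_eq_iff)
qed (use free in blast)+

text \<open>The decisive attack: P1 owns a 4-cycle with a further edge \<open>{p, u}\<close> and is to move. Three forcing
moves give \<open>l\<close> three new neighbours, and then \<open>p\<close>, which already shares \<open>u\<close> with \<open>l\<close>, makes a double
threat. The edge \<open>{p, u}\<close> may be a chord of the 4-cycle (\<open>p = w\<close>).\<close>
lemma attack:
  assumes pos: "position (4 + j) P Q" and safe: "safe P Q" and m: "\<not> on_c4 Q m"
    and V: "l \<in> V" "m \<in> V" "p \<in> V"
    and c4: "distinct [l, m, u, w]" "{l, u} \<in> P" "{l, w} \<in> P" "{m, u} \<in> P" "{m, w} \<in> P"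
    and p: "{p, u} \<in> P" "p \<notin> {l, m, u}"
  shows "wins 5 P Q"
proof -
  have "wins (Suc (Suc (Suc 2))) P Q"
  proof (rule threat_step[OF _ safe m V(1,2) c4])
    show "position (Suc (3 + j)) P Q" using pos by (simp add: numeral_eq_Suc)
    fix d1 let ?P1 = "insert {l, d1} P" and ?Q1 = "insert {m, d1} Q"
    assume d1: "d1 \<in> V" "\<And>e. e \<in> P \<Longrightarrow> d1 \<notin> e" "\<And>e. e \<in> Q \<Longrightarrow> d1 \<notin> e"
      and 1: "position (3 + j) ?P1 ?Q1" "safe ?P1 ?Q1" "\<not> on_c4 ?Q1 m"
    show "wins (Suc (Suc 2)) ?P1 ?Q1"
    proof (rule threat_step[OF _ 1(2,3) V(1,2) c4(1)])
      show "position (Suc (2 + j)) ?P1 ?Q1" using 1(1) by (simp add: numeral_eq_Suc)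
      fix d2 let ?P2 = "insert {l, d2} ?P1" and ?Q2 = "insert {m, d2} ?Q1"
      assume d2: "d2 \<in> V" "\<And>e. e \<in> ?P1 \<Longrightarrow> d2 \<notin> e" "\<And>e. e \<in> ?Q1 \<Longrightarrow> d2 \<notin> e"
        and 2: "position (2 + j) ?P2 ?Q2" "safe ?P2 ?Q2" "\<not> on_c4 ?Q2 m"
      show "wins (Suc 2) ?P2 ?Q2"
      proof (rule threat_step[OF _ 2(2,3) V(1,2) c4(1)])
        show "position (Suc (1 + j)) ?P2 ?Q2" using 2(1) by (simp add: numeral_eq_Suc)
        fix d3 let ?P3 = "insert {l, d3} ?P2" and ?Q3 = "insert {m, d3} ?Q2"
        assume d3: "d3 \<in> V" "\<And>e. e \<in> ?P2 \<Longrightarrow> d3 \<notin> e" "\<And>e. e \<in> ?Q2 \<Longrightarrow> d3 \<notin> e"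
          and 3: "position (1 + j) ?P3 ?Q3" "safe ?P3 ?Q3" "\<not> on_c4 ?Q3 m"
        have dd: "d2 \<noteq> d1" "d3 \<noteq> d1" "d3 \<noteq> d2"
          using d2(2)[of "{l, d1}"] d3(2)[of "{l, d1}"] d3(2)[of "{l, d2}"] by blast+
        have d1n: "d1 \<noteq> l" "d1 \<noteq> m" "d1 \<noteq> p" "d1 \<noteq> u"
          using d1(2)[OF c4(2)] d1(2)[OF c4(4)] d1(2)[OF p(1)] by blast+
        have d2n: "d2 \<noteq> l" "d2 \<noteq> m" "d2 \<noteq> p" "d2 \<noteq> u"
          using d2(2)[OF insertI2[OF c4(2)]] d2(2)[OF insertI2[OF c4(4)]] d2(2)[OF insertI2[OF p(1)]] by blast+
        have d3n: "d3 \<noteq> l" "d3 \<noteq> m" "d3 \<noteq> p" "d3 \<noteq> u"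
          using d3(2)[OF insertI2[OF insertI2[OF c4(2)]]] d3(2)[OF insertI2[OF insertI2[OF c4(4)]]]
            d3(2)[OF insertI2[OF insertI2[OF p(1)]]] by blast+
        have old: "{p, d} \<notin> P" "{p, d} \<notin> Q" if "d \<in> {d1, d2, d3}" for d
          using that d1(2,3) d2(2,3) d3(2,3) by blast+
        have new: "{p, d} \<in> E - (?P3 \<union> ?Q3)" if "d \<in> {d1, d2, d3}" for d
        proof -
          have "d \<in> V" "d \<noteq> p" "d \<noteq> l" "d \<noteq> m" using that d1(1) d2(1) d3(1) d1n d2n d3n by blast+
          moreover from this have "{p, d} \<noteq> {l, x}" "{p, d} \<noteq> {m, x}" for x
            using p(2) by (auto simp: doubleton_eq_iff)
          ultimately show ?thesis using old[OF that] edge_in_V[OF V(3), of d] by simp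
        qed
        show "wins 2 ?P3 ?Q3"
        proof (rule star_finish[of j _ _ l p u d1 d2 d3])
          show "position (Suc j) ?P3 ?Q3" using 3(1) by simp
          show "distinct [l, p, u, d1, d2, d3]" using dd d1n d2n d3n p(2) c4(1) by auto
          show "safe ?P3 ?Q3" by (rule 3(2))
          show "{u, l} \<in> ?P3" "{u, p} \<in> ?P3" using c4(2) p(1) by (simp_all add: edge_commute)
          show "{p, d1} \<in> E - (?P3 \<union> ?Q3)" "{p, d2} \<in> E - (?P3 \<union> ?Q3)" "{p, d3} \<in> E - (?P3 \<union> ?Q3)"
            by (rule new; simp)+
        qed simp_all
      qed (use c4 in simp_all)
    qed (use c4 in simp_all)
  qed simp
  then show ?thesis by (simp add: eval_nat_numeral)
qed

end

section \<open>New 4-cycles of the opponent\<close>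

definition path4 :: "'a set set \<Rightarrow> 'a \<Rightarrow> 'a \<Rightarrow> 'a \<Rightarrow> 'a \<Rightarrow> bool" where
  "path4 F p q r s \<longleftrightarrow> distinct [p, q, r, s] \<and> {p, q} \<in> F \<and> {q, r} \<in> F \<and> {r, s} \<in> F"

lemma path4_reverse: "path4 F p q r s \<Longrightarrow> path4 F s r q p"
  by (auto simp: path4_def edge_commute)

text \<open>A new 4-cycle is a path on four vertices closed by the new edge. The path is read in the direction
that makes \<open>p\<close> its first or second vertex, so that the opposite vertex \<open>r\<close> is two steps later.\<close>
lemma c4_insertE:
  assumes "c4 (insert f F) p q r s" "\<not> c4 F p q r s"
  obtains a b c d where "path4 F a b c d" "f = {a, d}" "{p, q, r, s} = {a, b, c, d}"
    "p = a \<and> r = c \<or> p = b \<and> r = d"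
proof -
  have d: "distinct [p, q, r, s]" and e: "{p, q} \<in> insert f F" "{q, r} \<in> insert f F"
    "{r, s} \<in> insert f F" "{s, p} \<in> insert f F" using assms(1) by (auto simp: c4_def)
  have ne: "{p, q} \<noteq> {q, r}" "{p, q} \<noteq> {r, s}" "{p, q} \<noteq> {s, p}" "{q, r} \<noteq> {r, s}"
    "{q, r} \<noteq> {s, p}" "{r, s} \<noteq> {s, p}" using d by (auto simp: doubleton_eq_iff)
  have "f = {p, q} \<or> f = {q, r} \<or> f = {r, s} \<or> f = {s, p}"
    using assms d e unfolding c4_def by (metis insertE)
  then consider "f = {p, q}" | "f = {q, r}" | "f = {r, s}" | "f = {s, p}" by metis
  then show ?thesis
  proof cases
    case 1
    then have "{s, p} \<in> F" "{r, s} \<in> F" "{q, r} \<in> F" using e ne by (metis insertE)+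
    then show ?thesis using 1 d by (intro that[of p s r q]) (auto simp: path4_def edge_commute)
  next
    case 2
    then have "{s, p} \<in> F" "{r, s} \<in> F" "{p, q} \<in> F" using e ne by (metis insertE)+
    then show ?thesis using 2 d by (intro that[of q p s r]) (auto simp: path4_def edge_commute)
  next
    case 3
    then have "{s, p} \<in> F" "{q, r} \<in> F" "{p, q} \<in> F" using e ne by (metis insertE)+
    then show ?thesis using 3 d by (intro that[of s p q r]) (auto simp: path4_def edge_commute)
  next
    case 4
    then have "{r, s} \<in> F" "{q, r} \<in> F" "{p, q} \<in> F" using e ne by (metis insertE)+
    then show ?thesis using 4 d by (intro that[of p q r s]) (auto simp: path4_def edge_commute)
  qed
qed

lemma not_on_c4_insert:
  assumes "\<And>p q r s. \<not> c4 F p q r s"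
    and "\<And>a b c d. path4 F a b c d \<Longrightarrow> f = {a, d} \<Longrightarrow> v \<notin> {a, b, c, d}"
  shows "\<not> on_c4 (insert f F) v"
proof
  assume "on_c4 (insert f F) v"
  then obtain q r s where "c4 (insert f F) v q r s" unfolding on_c4_def by blast
  from c4_insertE[OF this assms(1)] obtain a b c d
    where "path4 F a b c d" "f = {a, d}" "{v, q, r, s} = {a, b, c, d}" by metis
  with assms(2)[of a b c d] show False by auto
qed

lemma safe_insert:
  assumes "\<And>p q r s. \<not> c4 F p q r s"
    and "\<And>a b c d t. \<lbrakk>path4 F a b c d; f = {a, d}; t \<notin> {a, b, c, d}; {a, t} \<in> F\<rbrakk> \<Longrightarrow> {c, t} \<in> P"
    and "\<And>a b c d t. \<lbrakk>path4 F a b c d; f = {a, d}; t \<notin> {a, b, c, d}; {b, t} \<in> F\<rbrakk> \<Longrightarrow> {d, t} \<in> P"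
  shows "safe P (insert f F)"
  unfolding safe_def
proof (intro allI impI)
  fix p q r s t
  assume c: "c4 (insert f F) p q r s" and t: "{p, t} \<in> insert f F" "t \<notin> {p, q, r, s}"
  from c4_insertE[OF c assms(1)] obtain a b c d where p: "path4 F a b c d" "f = {a, d}"
    and s: "{p, q, r, s} = {a, b, c, d}" and pr: "p = a \<and> r = c \<or> p = b \<and> r = d" by metis
  have t': "t \<notin> {a, b, c, d}" using t(2) unfolding s .
  then have "{p, t} \<in> F" using t(1) p(2) by (auto simp: doubleton_eq_iff)
  then show "{r, t} \<in> P" using assms(2,3)[OF p t'] pr by blast
qed

lemma safe_if_no_c4: "(\<And>p q r s. \<not> c4 F p q r s) \<Longrightarrow> safe P F"
  unfolding safe_def by blast

lemma k23_card:
  assumes "k23 F" "finite F"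
  shows "6 \<le> card F"
proof -
  from assms(1) obtain u v a b c where d: "distinct [u, v, a, b, c]"
    and e: "{u, a} \<in> F" "{u, b} \<in> F" "{u, c} \<in> F" "{v, a} \<in> F" "{v, b} \<in> F" "{v, c} \<in> F"
    by (rule k23_E)
  have "card (set [{u, a}, {u, b}, {u, c}, {v, a}, {v, b}, {v, c}]) = 6"
    by (subst distinct_card) (use d in \<open>auto simp: doubleton_eq_iff\<close>)
  moreover have "set [{u, a}, {u, b}, {u, c}, {v, a}, {v, b}, {v, c}] \<subseteq> F" using e by simp
  ultimately show ?thesis using card_mono[OF assms(2)] by metis
qed

lemma c4_card:
  assumes "c4 F p q r s" "finite F"
  shows "4 \<le> card F"
proof -
  have "card (set [{p, q}, {q, r}, {r, s}, {s, p}]) = 4"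
    by (subst distinct_card) (use assms(1) in \<open>auto simp: c4_def doubleton_eq_iff\<close>)
  moreover have "set [{p, q}, {q, r}, {r, s}, {s, p}] \<subseteq> F" using assms(1) by (simp add: c4_def)
  ultimately show ?thesis using card_mono[OF assms(2)] by metis
qed

lemma card_insert_le_Suc: "card F \<le> k \<Longrightarrow> card (insert f F) \<le> Suc k"
  by (rule card_insert_le_m1) auto

section \<open>From a star to a 4-cycle\<close>

context k23_game begin

lemma attack_either:
  assumes "position (4 + j) P Q" "safe P Q" "\<not> on_c4 Q l \<or> \<not> on_c4 Q m"
    and "l \<in> V" "m \<in> V" "p \<in> V"
    and "distinct [l, m, u, w]" "{l, u} \<in> P" "{l, w} \<in> P" "{m, u} \<in> P" "{m, w} \<in> P"
    and "{p, u} \<in> P" "p \<notin> {l, m, u}"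
  shows "wins 5 P Q"
  using assms(3)
proof
  assume "\<not> on_c4 Q m"
  then show ?thesis using attack[of j P Q m l p u w] assms by simp
next
  assume "\<not> on_c4 Q l"
  then show ?thesis using attack[of j P Q l m p u w] assms by simp metis
qed

text \<open>What \<open>attack\<close> needs to know about P2, where \<open>l\<close> and \<open>m\<close> are opposite vertices of the 4-cycle of P1: the
attack may start from either of them.\<close>
definition ripe :: "'a set set \<Rightarrow> 'a set set \<Rightarrow> 'a \<Rightarrow> 'a \<Rightarrow> bool" where
  "ripe P Q l m \<longleftrightarrow> safe P Q \<and> (\<not> on_c4 Q l \<or> \<not> on_c4 Q m)"

text \<open>P1 owns a star with centre \<open>u\<close> and leaves \<open>l\<close>, \<open>m\<close>, \<open>m'\<close> and plays \<open>{w, l}\<close>. Now \<open>{w, m}\<close> and \<open>{w, m'}\<close> both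
complete a 4-cycle through \<open>u\<close>, and the remaining leaf is then the pendant vertex. If P2 takes one of the
two edges, P1 takes the other and P2 has a free move \<open>f\<close>; if P2 uses the free move \<open>f\<close> first, then P1
takes \<open>{w, m}\<close> and P2 must answer \<open>{w, m'}\<close>. Either way P2 has added one edge at \<open>w\<close> and one arbitrary
edge \<open>f\<close>.\<close>
lemma spider:
  assumes pos: "position (6 + j) P Q" and Q3: "card Q \<le> 3"
    and V: "u \<in> V" "l \<in> V" "m \<in> V" "m' \<in> V" "w \<in> V" "distinct [u, l, m, m', w]"
    and P: "{u, l} \<in> P" "{u, m} \<in> P" "{u, m'} \<in> P"
    and free: "{w, l} \<notin> P \<union> Q" "{w, m} \<notin> P \<union> Q" "{w, m'} \<notin> P \<union> Q"
    and ripe: "\<And>x y f. \<lbrakk>x = m \<and> y = m' \<or> x = m' \<and> y = m; f \<in> E; f \<notin> P; f \<noteq> {w, l}; f \<noteq> {w, y}\<rbrakk>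
      \<Longrightarrow> ripe (insert {w, y} (insert {w, l} P)) (insert f (insert {w, x} Q)) l y"
  shows "wins 7 P Q"
proof -
  let ?P = "insert {w, l} P"
  have E: "{w, l} \<in> E" "{w, m} \<in> E" "{w, m'} \<in> E" using edge_in_V V by auto
  have neq: "{w, l} \<noteq> {w, m}" "{w, l} \<noteq> {w, m'}" "{w, m} \<noteq> {w, m'}"
    using V(6) by (auto simp: doubleton_eq_iff)
  have fin: "finite Q" using pos by (simp add: position_def)
  have final: "wins 5 (insert {w, y} ?P) (insert f (insert {w, x} Q))"
    if "position (4 + j) (insert {w, y} ?P) (insert f (insert {w, x} Q))"
      "x = m \<and> y = m' \<or> x = m' \<and> y = m" "f \<in> E" "f \<notin> P" "f \<noteq> {w, l}" "f \<noteq> {w, y}" for x y f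
  proof (rule attack_either[OF that(1), of l y x u w])
    show "safe (insert {w, y} ?P) (insert f (insert {w, x} Q))"
      "\<not> on_c4 (insert f (insert {w, x} Q)) l \<or> \<not> on_c4 (insert f (insert {w, x} Q)) y"
      using ripe[OF that(2-)] unfolding ripe_def by auto
  qed (use V P that(2) in \<open>auto simp: edge_commute\<close>)
  have "wins (Suc 6) P Q"
  proof (rule wins_step[where e = "{w, l}" and j = "5 + j"])
    show "position (Suc (5 + j)) P Q" using pos by (simp add: numeral_eq_Suc)
    fix f let ?Q = "insert f Q"
    assume f: "f \<in> E" "f \<notin> P" "f \<notin> Q" "f \<noteq> {w, l}" and pos1: "position (5 + j) ?P ?Q"
    have c: "card ?Q \<le> 4" using card_insert_le_Suc[OF Q3, of f] by simp
    have pos1': "position (Suc (4 + j)) ?P ?Q" using pos1 by (simp add: numeral_eq_Suc)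
    have no: "\<not> k23 (insert g ?Q)" for g
      using k23_card[of "insert g ?Q"] card_insert_le_Suc[OF c, of g] fin by auto
    have "wins (Suc 5) ?P ?Q"
    proof (cases "f \<in> {{w, m}, {w, m'}}")
      case True
      then obtain x y where xy: "x = m \<and> y = m' \<or> x = m' \<and> y = m" "f = {w, x}" by auto
      show ?thesis
      proof (rule wins_step[OF pos1', of "{w, y}"])
        fix g assume g: "g \<in> E" "g \<notin> ?P" "g \<noteq> {w, y}"
          "position (4 + j) (insert {w, y} ?P) (insert g ?Q)"
        then show "\<not> k23 (insert g ?Q) \<and> wins 5 (insert {w, y} ?P) (insert g ?Q)"
          using no final[of y g x] xy by simp
      qed (use xy E free neq in auto)
    next
      case False
      show ?thesis
      proof (rule wins_force[OF pos1', where e = "{w, m}" and g = "{w, m'}"])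
        show "k23 (insert {w, m'} (insert {w, m} ?P))"
          by (rule k23_I[of w u l m m']) (use V P in auto)
        assume "position (4 + j) (insert {w, m} ?P) (insert {w, m'} ?Q)"
        then show "wins 5 (insert {w, m} ?P) (insert {w, m'} ?Q)"
          using final[of m f m'] f False by (simp add: insert_commute[of "{w, m'}" f])
      qed (use E free neq False no in auto)
    qed
    moreover have "\<not> k23 ?Q" using k23_card[of ?Q] c fin by auto
    ultimately show "\<not> k23 ?Q \<and> wins 6 ?P ?Q" by simp
  qed (use E free in auto)
  then show ?thesis by simp
qed

end

section \<open>Replies that leave no open path\<close>

lemma path4_insert_pendantE:
  assumes "path4 (insert {w, x} Q) a b c d" "\<And>e. e \<in> Q \<Longrightarrow> w \<notin> e" "\<not> path4 Q a b c d"
  shows "a = w \<and> b = x \<and> {x, c} \<in> Q \<and> {c, d} \<in> Q \<or> d = w \<and> c = x \<and> {x, b} \<in> Q \<and> {b, a} \<in> Q"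
proof -
  have d: "distinct [a, b, c, d]" and e: "{a, b} = {w, x} \<or> {a, b} \<in> Q"
    "{b, c} = {w, x} \<or> {b, c} \<in> Q" "{c, d} = {w, x} \<or> {c, d} \<in> Q"
    using assms(1) by (auto simp: path4_def)
  have "w \<in> {a, b, c, d}"
  proof (rule ccontr)
    assume "w \<notin> {a, b, c, d}"
    then have "{a, b} \<noteq> {w, x}" "{b, c} \<noteq> {w, x}" "{c, d} \<noteq> {w, x}" by auto
    then show False using e d assms(3) by (simp add: path4_def)
  qed
  moreover have "b \<noteq> w" "c \<noteq> w"
    using e d assms(2)[of "{a, b}"] assms(2)[of "{b, c}"] assms(2)[of "{c, d}"]
    by (auto simp: doubleton_eq_iff)
  ultimately consider "a = w" | "d = w" by auto
  then show ?thesis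
  proof cases
    case 1
    then have "b = x" using e(1) assms(2)[of "{a, b}"] by (auto simp: doubleton_eq_iff)
    then show ?thesis using 1 d e(2,3) by (auto simp: doubleton_eq_iff)
  next
    case 2
    then have "c = x" using e(3) assms(2)[of "{c, d}"] by (auto simp: doubleton_eq_iff)
    then show ?thesis using 2 d e(1,2) by (auto simp: doubleton_eq_iff edge_commute)
  qed
qed

context k23_game begin

text \<open>With a new vertex \<open>w\<close>, the 4-cycles of P2 after its two further edges are \<open>w x z e\<close> with \<open>{x, z}\<close> and
\<open>{z, e}\<close> among its first three edges; closing a path of these three edges is impossible because P1 owns
all the closing edges. If the third edge is \<open>{x, t}\<close> or \<open>{e, t}\<close>, it forms a path with the other two,
and its closing edge is just the edge that P2 would need to complete \<open>K\<^sub>2\<^sub>,\<^sub>3\<close>. If it is \<open>{z, t}\<close>, the needed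
edge is \<open>{w, t}\<close>; the assumption \<open>centre\<close> makes \<open>t = l\<close>, and \<open>{w, l}\<close> belongs to P1.\<close>
lemma spider_closed_paths:
  assumes pos: "position (6 + j) P Q" and Q3: "card Q \<le> 3"
    and V: "u \<in> V" "l \<in> V" "m \<in> V" "m' \<in> V" "distinct [u, l, m, m']"
    and P: "P = {{u, l}, {u, m}, {u, m'}}"
    and closed: "\<And>a b c d. path4 Q a b c d \<Longrightarrow> {a, d} \<in> P"
    and centre: "\<And>z x1 x2 x3. \<lbrakk>distinct [x1, x2, x3]; {z, x1} \<in> Q; {z, x2} \<in> Q; {z, x3} \<in> Q;
      x1 \<in> {m, m'}\<rbrakk> \<Longrightarrow> l \<in> {x2, x3}"
  shows "wins 7 P Q"
proof -
  obtain w where w: "w \<in> V" "\<And>e. e \<in> P \<Longrightarrow> w \<notin> e" "\<And>e. e \<in> Q \<Longrightarrow> w \<notin> e"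
    using position_fresh[OF pos] by blast
  have wne: "w \<noteq> u" "w \<noteq> l" "w \<noteq> m" "w \<noteq> m'"
    using w(2)[of "{u, l}"] w(2)[of "{u, m}"] w(2)[of "{u, m'}"] P by auto
  have free: "{w, v} \<notin> P \<union> Q" for v using w(2,3) by blast
  have disj: "P \<inter> Q = {}" and fin: "finite Q" using pos by (auto simp: position_def)
  show ?thesis
  proof (rule spider[OF pos Q3 V(1-4) w(1)])
    fix x y f
    assume xy: "x = m \<and> y = m' \<or> x = m' \<and> y = m" and f: "f \<noteq> {w, l}" "f \<noteq> {w, y}" "f \<notin> P"
    let ?P = "insert {w, y} (insert {w, l} P)" and ?R = "insert {w, x} Q"
    have xne: "x \<noteq> y" "x \<noteq> l" "y \<noteq> l" "x \<noteq> w" using xy V(5) wne by auto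
    have no_c4: "\<not> c4 ?R p q r s" for p q r s
      using c4_insert_pendant[of x w Q p q r s] w(3) c4_card[OF _ fin, of p q r s] Q3
      by (auto simp: edge_commute)
    have path: "a = w \<and> b = x \<and> {x, c} \<in> Q \<and> {c, d} \<in> Q \<or> d = w \<and> c = x \<and> {x, b} \<in> Q \<and> {b, a} \<in> Q"
      "distinct [a, b, c, d]" if p: "path4 ?R a b c d" "f = {a, d}" for a b c d
    proof -
      have "\<not> path4 Q a b c d" using closed p(2) f(3) by blast
      from path4_insert_pendantE[OF p(1) w(3) this]
      show "a = w \<and> b = x \<and> {x, c} \<in> Q \<and> {c, d} \<in> Q \<or> d = w \<and> c = x \<and> {x, b} \<in> Q \<and> {b, a} \<in> Q" .
      show "distinct [a, b, c, d]" using p(1) by (simp add: path4_def)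
    qed
    have "safe ?P (insert f ?R)"
    proof (rule safe_insert[OF no_c4])
      fix a b c d t
      assume p: "path4 ?R a b c d" "f = {a, d}" and t: "t \<notin> {a, b, c, d}" "{a, t} \<in> ?R"
      have "a \<noteq> w" using path[OF p] t w(3)[of "{a, t}"] by (auto simp: doubleton_eq_iff)
      then have q: "d = w" "c = x" "{x, b} \<in> Q" "{b, a} \<in> Q" using path[OF p] by auto
      have "{a, t} \<in> Q" using t q \<open>a \<noteq> w\<close> by (auto simp: doubleton_eq_iff)
      then have "path4 Q x b a t" using q t path(2)[OF p] by (auto simp: path4_def)
      then show "{c, t} \<in> ?P" using closed[of x b a t] q(2) by simp
    next
      fix a b c d t
      assume p: "path4 ?R a b c d" "f = {a, d}" and t: "t \<notin> {a, b, c, d}" "{b, t} \<in> ?R"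
      have bt: "{b, t} \<in> Q" using path[OF p] t by (auto simp: doubleton_eq_iff)
      show "{d, t} \<in> ?P"
      proof (cases "a = w")
        case True
        then have "path4 Q t b c d" using path[OF p] bt t w(3)[of "{c, d}"]
          by (auto simp: path4_def edge_commute)
        then show ?thesis using closed[of t b c d] by (simp add: edge_commute)
      next
        case False
        then have q: "d = w" "c = x" "{x, b} \<in> Q" "{b, a} \<in> Q" using path[OF p] by auto
        have "l \<in> {a, t}"
          by (rule centre[of x a t b])
            (use q bt t path(2)[OF p] xy in \<open>auto simp: edge_commute\<close>)
        moreover have "l \<noteq> a" using f(1) p(2) q(1) by (auto simp: edge_commute)
        ultimately show ?thesis using q(1) by simp
      qed
    qed
    moreover have "\<not> on_c4 (insert f ?R) l \<or> \<not> on_c4 (insert f ?R) y"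
    proof (rule ccontr)
      assume c: "\<not> ?thesis"
      \<comment> \<open>A 4-cycle through \<open>v\<close> makes \<open>v\<close> the neighbour of \<open>x\<close> opposite to \<open>w\<close>.\<close>
      have mid: "\<exists>e. f = {w, e} \<and> {x, v} \<in> Q \<and> {v, e} \<in> Q \<and> e \<noteq> x"
        if v: "on_c4 (insert f ?R) v" "v = l \<or> v = y" for v
      proof -
        obtain a b c d where p: "path4 ?R a b c d" "f = {a, d}" and vp: "v \<in> {a, b, c, d}"
          using v(1) not_on_c4_insert[OF no_c4, of f v] by blast
        have vne: "v \<noteq> w" "v \<noteq> x" "f \<noteq> {w, v}" using v(2) wne(2-4) xy f xne(1,2) by blast+
        from path(1)[OF p] show ?thesis
        proof
          assume q: "a = w \<and> b = x \<and> {x, c} \<in> Q \<and> {c, d} \<in> Q"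
          then have "v = c" using p(2) vp vne by blast
          with q p(2) path(2)[OF p] show ?thesis by auto
        next
          assume q: "d = w \<and> c = x \<and> {x, b} \<in> Q \<and> {b, a} \<in> Q"
          then have "f = {w, a}" using p(2) by (simp add: edge_commute)
          then have "v = b" using vp q vne by blast
          with q \<open>f = {w, a}\<close> path(2)[OF p] show ?thesis by auto
        qed
      qed
      obtain e where e: "f = {w, e}" "{x, l} \<in> Q" "{l, e} \<in> Q" "e \<noteq> x" using mid[of l] c by auto
      obtain e' where e': "f = {w, e'}" "{x, y} \<in> Q" "{y, e'} \<in> Q" using mid[of y] c by auto
      have "e' = e" using e(1) e'(1) by (auto simp: doubleton_eq_iff)
      moreover have "e \<noteq> l" "e \<noteq> y" using f e(1) by auto
      ultimately have "path4 Q l x y e"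
        using e(2,4) e'(2,3) xne unfolding path4_def by (auto simp: edge_commute)
      then show False using closed[of l x y e] e(3) disj by blast
    qed
    ultimately show "ripe ?P (insert f ?R) l y" unfolding ripe_def by blast
  qed (use V(5) wne P free in auto)
qed

text \<open>The choice of the leaf \<open>l\<close> that meets the assumption \<open>centre\<close>: if the edges of P2 form a star that has a
leaf of P1 among its ends, such a leaf is taken, and otherwise any leaf will do.\<close>
lemma star_closed_paths:
  assumes pos: "position (6 + j) P Q" and Q3: "card Q \<le> 3"
    and V: "u \<in> V" "a \<in> V" "b \<in> V" "c \<in> V" "distinct [u, a, b, c]"
    and P: "P = {{u, a}, {u, b}, {u, c}}"
    and closed: "\<And>p q r s. path4 Q p q r s \<Longrightarrow> {p, s} \<in> P"
  shows "wins 7 P Q"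
proof (cases "\<forall>z x1 x2 x3. distinct [x1, x2, x3] \<longrightarrow> {z, x1} \<in> Q \<longrightarrow> {z, x2} \<in> Q \<longrightarrow> {z, x3} \<in> Q
    \<longrightarrow> x1 \<notin> {a, b, c}")
  case True
  show ?thesis
  proof (rule spider_closed_paths[OF pos Q3 V P closed])
    fix z x1 x2 x3
    assume "distinct [x1, x2, x3]" "{z, x1} \<in> Q" "{z, x2} \<in> Q" "{z, x3} \<in> Q" "x1 \<in> {b, c}"
    with True[rule_format, of x1 x2 x3 z] have False by simp
    then show "a \<in> {x2, x3}" ..
  qed
next
  case False
  then obtain z l x2 x3 where s: "distinct [l, x2, x3]" "{z, l} \<in> Q" "{z, x2} \<in> Q" "{z, x3} \<in> Q"
    and l: "l \<in> {a, b, c}" by blast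
  have "{z, l} \<noteq> {z, x2}" "{z, l} \<noteq> {z, x3}" "{z, x2} \<noteq> {z, x3}"
    using s(1) by (auto simp: doubleton_eq_iff)
  then have "card {{z, l}, {z, x2}, {z, x3}} = 3" by (simp add: card_insert_if)
  moreover have "finite Q" using pos by (simp add: position_def)
  ultimately have Q: "Q = {{z, l}, {z, x2}, {z, x3}}"
    using card_seteq[of Q "{{z, l}, {z, x2}, {z, x3}}"] s Q3 by auto
  have centre: "l \<in> {y2, y3}"
    if d: "distinct [y1, y2, y3]" and e: "{z', y1} \<in> Q" "{z', y2} \<in> Q" "{z', y3} \<in> Q" and "y1 \<noteq> l"
    for z' y1 y2 y3
  proof -
    have "z' = z"
    proof (rule ccontr)
      assume "z' \<noteq> z"
      then have "y = z" if "{z', y} \<in> Q" for y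
        using that unfolding Q by (auto simp: doubleton_eq_iff)
      from this[OF e(1)] this[OF e(2)] d show False by simp
    qed
    then have "y \<in> {l, x2, x3}" if "{z', y} \<in> Q" for y
      using that unfolding Q by (auto simp: doubleton_eq_iff)
    from this[OF e(1)] this[OF e(2)] this[OF e(3)] show ?thesis
      using d \<open>y1 \<noteq> l\<close> by auto
  qed
  from l consider "l = a" | "l = b" | "l = c" by blast
  then show ?thesis
  proof cases
    case 1
    show ?thesis by (rule spider_closed_paths[OF pos Q3 V P closed]) (use centre V(5) 1 in auto)
  next
    case 2
    show ?thesis by (rule spider_closed_paths[OF pos Q3 V(1,3,2,4) _ _ closed])
      (use centre V(5) 2 P in auto)
  next
    case 3
    show ?thesis by (rule spider_closed_paths[OF pos Q3 V(1,4,2,3) _ _ closed])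
      (use centre V(5) 3 P in auto)
  qed
qed

end

section \<open>Replies that form an open path\<close>

lemma path4_set:
  assumes "path4 F p q r s" "finite F" "card F \<le> 3"
  shows "F = {{p, q}, {q, r}, {r, s}}"
proof -
  have "{p, q} \<noteq> {q, r}" "{p, q} \<noteq> {r, s}" "{q, r} \<noteq> {r, s}"
    using assms(1) by (auto simp: path4_def doubleton_eq_iff)
  then have "card {{p, q}, {q, r}, {r, s}} = 3" by (simp add: card_insert_if)
  moreover have "{{p, q}, {q, r}, {r, s}} \<subseteq> F" using assms(1) by (simp add: path4_def)
  ultimately show ?thesis using card_seteq[OF assms(2)] assms(3) by metis
qed

context k23_game begin

text \<open>As \<open>x\<close> is untouched, the edge \<open>{w, x}\<close> is isolated in the graph of P2 and a 4-cycle can only close a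
path consisting of all three earlier edges. It has no pendant edge and it misses the leaf \<open>y\<close>.\<close>
lemma spider_untouched:
  assumes pos: "position (6 + j) P Q" and Q3: "card Q \<le> 3"
    and V: "u \<in> V" "l \<in> V" "m \<in> V" "m' \<in> V" "distinct [u, l, m, m']"
    and P: "P = {{u, l}, {u, m}, {u, m'}}"
    and untouched: "\<And>e. e \<in> Q \<Longrightarrow> m \<notin> e \<and> m' \<notin> e"
  shows "wins 7 P Q"
proof -
  obtain w where w: "w \<in> V" "\<And>e. e \<in> P \<Longrightarrow> w \<notin> e" "\<And>e. e \<in> Q \<Longrightarrow> w \<notin> e"
    using position_fresh[OF pos] by blast
  have wne: "w \<noteq> u" "w \<noteq> l" "w \<noteq> m" "w \<noteq> m'"
    using w(2)[of "{u, l}"] w(2)[of "{u, m}"] w(2)[of "{u, m'}"] P by auto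
  have free: "{w, v} \<notin> P \<union> Q" for v using w(2,3) by blast
  have fin: "finite Q" using pos by (simp add: position_def)
  show ?thesis
  proof (rule spider[OF pos Q3 V(1-4) w(1)])
    fix x y f
    assume xy: "x = m \<and> y = m' \<or> x = m' \<and> y = m"
    let ?P = "insert {w, y} (insert {w, l} P)" and ?R = "insert {w, x} Q"
    have xQ: "x \<notin> e" "y \<notin> e" if "e \<in> Q" for e using untouched[OF that] xy by auto
    have no_c4: "\<not> c4 ?R p q r s" for p q r s
      using c4_insert_pendant[of x w Q p q r s] w(3) c4_card[OF _ fin, of p q r s] Q3
      by (auto simp: edge_commute)
    have path: "path4 Q a b c d" if "path4 ?R a b c d" for a b c d
      using path4_insert_pendantE[OF that w(3)] xQ(1)[of "{x, c}"] xQ(1)[of "{x, b}"] by blast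
    have edges: "Q = {{a, b}, {b, c}, {c, d}}" "distinct [a, b, c, d]" "w \<notin> {a, b, c, d}"
      "y \<notin> {a, b, c, d}" if "path4 ?R a b c d" for a b c d
    proof -
      show Q: "Q = {{a, b}, {b, c}, {c, d}}" using path4_set[OF path[OF that] fin Q3] .
      show "distinct [a, b, c, d]" using that by (simp add: path4_def)
      show "w \<notin> {a, b, c, d}" "y \<notin> {a, b, c, d}"
        using w(3)[of "{a, b}"] w(3)[of "{c, d}"] xQ(2)[of "{a, b}"] xQ(2)[of "{c, d}"] unfolding Q by auto
    qed
    have "safe ?P (insert f ?R)"
    proof (rule safe_insert[OF no_c4])
      fix a b c d t
      assume p: "path4 ?R a b c d" and t: "t \<notin> {a, b, c, d}" "{a, t} \<in> ?R"
      have "{a, t} \<in> Q" using t edges(3)[OF p] path[OF p] xQ(1)[of "{a, b}"]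
        by (auto simp: doubleton_eq_iff path4_def)
      then show "{c, t} \<in> ?P" using t(1) edges(2)[OF p] unfolding edges(1)[OF p]
        by (auto simp: doubleton_eq_iff)
    next
      fix a b c d t
      assume p: "path4 ?R a b c d" and t: "t \<notin> {a, b, c, d}" "{b, t} \<in> ?R"
      have "{b, t} \<in> Q" using t edges(3)[OF p] path[OF p] xQ(1)[of "{a, b}"]
        by (auto simp: doubleton_eq_iff path4_def)
      then show "{d, t} \<in> ?P" using t(1) edges(2)[OF p] unfolding edges(1)[OF p]
        by (auto simp: doubleton_eq_iff)
    qed
    moreover have "\<not> on_c4 (insert f ?R) y"
      by (rule not_on_c4_insert[OF no_c4]) (use edges(4) in blast)
    ultimately show "ripe ?P (insert f ?R) l y" unfolding ripe_def by blast
  qed (use V(5) wne P free in auto)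
qed

text \<open>P2 has a path that starts with two leaves \<open>g\<close>, \<open>h\<close> of P1 and ends in \<open>x\<close>. P1 uses \<open>x\<close> as the vertex \<open>w\<close> of
\<open>spider\<close>: the first move \<open>{x, g}\<close> keeps P2 from closing this path and is the edge that P2 would miss
if it got the 4-cycle \<open>h y x k\<close> with the pendant edge \<open>{h, g}\<close>.\<close>
lemma path_from_two_leaves:
  assumes pos: "position (6 + j) P Q"
    and V: "u \<in> V" "g \<in> V" "h \<in> V" "k \<in> V" "x \<in> V" "distinct [u, g, h, k, x]"
    and P: "P = {{u, g}, {u, h}, {u, k}}" and Q: "Q = {{g, h}, {h, y}, {y, x}}"
    and path: "path4 Q g h y x" and k: "k \<noteq> y"
  shows "wins 7 P Q"
proof -
  have d: "distinct [g, h, y, x]" using path by (simp add: path4_def)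
  have ne: "u \<noteq> y"
    using pos V(6) d unfolding P Q position_def by (auto simp: doubleton_eq_iff)
  show ?thesis
  proof (rule spider[OF pos, of u g h k x])
    fix x1 y1 f
    let ?P = "insert {x, y1} (insert {x, g} P)" and ?R = "insert {x, x1} Q"
    assume xy: "x1 = h \<and> y1 = k \<or> x1 = k \<and> y1 = h" and f: "f \<notin> P" "f \<noteq> {x, g}" "f \<noteq> {x, y1}"
    show "ripe ?P (insert f ?R) g y1"
      using xy
    proof
      assume "x1 = h \<and> y1 = k"
      then have R: "?R = {{x, h}, {g, h}, {h, y}, {y, x}}" and y1: "y1 = k" unfolding Q by auto
      have p: "a = g \<and> b = h \<and> c = x \<and> d = y \<or> a = y \<and> b = x \<and> c = h \<and> d = g"
        if "path4 ?R a b c d" "f = {a, d}" for a b c d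
        using that V(6) d k ne f unfolding R path4_def by (auto simp: doubleton_eq_iff)
      have no_c4: "\<not> c4 ?R a b c d'" for a b c d'
        using V(6) d k ne unfolding R c4_def by (auto simp: doubleton_eq_iff)
      have "safe ?P (insert f ?R)"
      proof (rule safe_insert[OF no_c4])
        fix a b c e t
        assume "path4 ?R a b c e" "f = {a, e}" and t: "t \<notin> {a, b, c, e}" "{a, t} \<in> ?R"
        from p[OF this(1,2)] t show "{c, t} \<in> ?P"
          using V(6) d unfolding R by (auto simp: doubleton_eq_iff)
      next
        fix a b c e t
        assume "path4 ?R a b c e" "f = {a, e}" and t: "t \<notin> {a, b, c, e}" "{b, t} \<in> ?R"
        from p[OF this(1,2)] t show "{e, t} \<in> ?P"
          using V(6) d unfolding R by (auto simp: doubleton_eq_iff)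
      qed
      moreover have "\<not> on_c4 (insert f ?R) k"
        by (rule not_on_c4_insert[OF no_c4]) (use p V(6) k in fastforce)
      ultimately show ?thesis unfolding ripe_def y1 by blast
    next
      assume "x1 = k \<and> y1 = h"
      then have R: "?R = {{x, k}, {g, h}, {h, y}, {y, x}}" and y1: "y1 = h" unfolding Q by auto
      have p: "a = h \<and> b = y \<and> c = x \<and> d = k \<or> a = k \<and> b = x \<and> c = y \<and> d = h"
        if "path4 ?R a b c d" "f = {a, d}" for a b c d
        using that V(6) d k ne f unfolding R path4_def by (auto simp: doubleton_eq_iff)
      have no_c4: "\<not> c4 ?R a b c d'" for a b c d'
        using V(6) d k ne unfolding R c4_def by (auto simp: doubleton_eq_iff)
      have "safe ?P (insert f ?R)"
      proof (rule safe_insert[OF no_c4])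
        fix a b c e t
        assume "path4 ?R a b c e" "f = {a, e}" and t: "t \<notin> {a, b, c, e}" "{a, t} \<in> ?R"
        from p[OF this(1,2)] t show "{c, t} \<in> ?P"
          using V(6) d k unfolding R by (auto simp: doubleton_eq_iff)
      next
        fix a b c e t
        assume "path4 ?R a b c e" "f = {a, e}" and t: "t \<notin> {a, b, c, e}" "{b, t} \<in> ?R"
        from p[OF this(1,2)] t show "{e, t} \<in> ?P"
          using V(6) d k unfolding R by (auto simp: doubleton_eq_iff)
      qed
      moreover have "\<not> on_c4 (insert f ?R) g"
        by (rule not_on_c4_insert[OF no_c4]) (use p V(6) d in fastforce)
      ultimately show ?thesis unfolding ripe_def y1 by blast
    qed
  next
    show "card Q \<le> 3" unfolding Q by (simp add: card_insert_if)
    show "{x, g} \<notin> P \<union> Q" "{x, h} \<notin> P \<union> Q" "{x, k} \<notin> P \<union> Q"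
      using V(6) d k ne unfolding P Q by (auto simp: doubleton_eq_iff)
  qed (use V P in simp_all)
qed

end

lemma path4_insertE:
  assumes "path4 (insert f F) p q r s"
  shows "path4 F p q r s \<or> f = {p, q} \<and> {q, r} \<in> F \<and> {r, s} \<in> F \<or>
    f = {q, r} \<and> {p, q} \<in> F \<and> {r, s} \<in> F \<or> f = {r, s} \<and> {p, q} \<in> F \<and> {q, r} \<in> F"
proof -
  have d: "distinct [p, q, r, s]" and e: "{p, q} = f \<or> {p, q} \<in> F" "{q, r} = f \<or> {q, r} \<in> F"
    "{r, s} = f \<or> {r, s} \<in> F" using assms by (auto simp: path4_def)
  have "{p, q} \<noteq> {q, r}" "{p, q} \<noteq> {r, s}" "{q, r} \<noteq> {r, s}"
    using d by (auto simp: doubleton_eq_iff)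
  then show ?thesis using d e unfolding path4_def by metis
qed

context k23_game begin

text \<open>P2 has the path \<open>b y t a\<close> between two leaves, and P1 has played \<open>{a, b}\<close>. With \<open>{a, c}\<close> P1 gets the 4-cycle
\<open>b a c u\<close> with the chord \<open>{u, a}\<close>, which serves as the additional edge of \<open>attack\<close>. Of the excluded
replies \<open>f\<close>, \<open>{a, c}\<close> takes this edge, and the other two let P2 aim at the 4-cycle \<open>b y t c\<close>; after any
other reply \<open>c\<close> is kept off the 4-cycles of P2.\<close>
lemma bridge_free:
  assumes pos: "position (5 + j) P Q"
    and V: "u \<in> V" "a \<in> V" "b \<in> V" "c \<in> V" "distinct [u, a, b, c]"
    and P: "P = {{u, a}, {u, b}, {u, c}, {a, b}}" and Q: "Q = insert f {{b, y}, {y, t}, {t, a}}"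
    and d: "distinct [b, y, t, a]" "u \<notin> {y, t}" "c \<notin> {y, t}"
    and f: "f \<notin> P" "f \<notin> {{a, c}, {b, c}, {c, t}}"
  shows "wins 6 P Q"
proof -
  let ?Q = "{{b, y}, {y, t}, {t, a}}" and ?P = "insert {a, c} P"
  have pos': "position (Suc (4 + j)) P Q" using pos by (simp add: numeral_eq_Suc)
  have fin: "finite Q" and disj: "P \<inter> Q = {}" using pos by (auto simp: position_def)
  have fne: "f \<noteq> {a, b}" "f \<noteq> {a, c}" "f \<noteq> {b, c}" "f \<noteq> {c, t}" using f P by auto
  have ne: "distinct [b, y, t, a, c]" using d V(5) by auto
  have old: "path4 ?Q p q r s \<Longrightarrow> {p, s} = {a, b}" for p q r s
    using d unfolding path4_def by (auto simp: doubleton_eq_iff)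
  have sub: "q = b \<and> r = y \<and> s = t \<or> q = t \<and> r = y \<and> s = b \<or> q = y \<and> r = t \<and> s = a
      \<or> q = a \<and> r = t \<and> s = y"
    if "{q, r} \<in> ?Q" "{r, s} \<in> ?Q" "q \<noteq> s" for q r s
    using that d by (auto simp: doubleton_eq_iff)
  have no_c4: "\<not> c4 Q p q r s" for p q r s
  proof
    assume c: "c4 Q p q r s"
    have "card ?Q \<le> 3" by (simp add: card_insert_if)
    then have "\<not> c4 ?Q p q r s" using c4_card[of ?Q p q r s] by auto
    from c4_insertE[OF c[unfolded Q] this] old obtain a' d' where "f = {a', d'}" "{a', d'} = {a, b}" by metis
    then show False using f(1) P by simp
  qed
  have path: "c \<notin> {p, q, r, s}"
    "\<And>z. z \<notin> {p, q, r, s} \<Longrightarrow> {p, z} \<in> Q \<Longrightarrow> {r, z} \<in> ?P"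
    "\<And>z. z \<notin> {p, q, r, s} \<Longrightarrow> {q, z} \<in> Q \<Longrightarrow> {s, z} \<in> ?P"
    if p: "path4 Q p q r s" and e: "{p, s} \<notin> ?P" for p q r s
  proof -
    have dist: "distinct [p, q, r, s]" using p by (simp add: path4_def)
    have "{a, b} \<in> ?P" using P by simp
    have ends: "{p, s} \<noteq> {a, b}" "{p, s} \<noteq> {a, c}" using e P by auto
    have no: "\<not> path4 ?Q p q r s" using old[of p q r s] ends(1) by metis
    have "f = {p, q} \<and> {q, r} \<in> ?Q \<and> {r, s} \<in> ?Q \<or> f = {q, r} \<and> {p, q} \<in> ?Q \<and> {r, s} \<in> ?Q
      \<or> f = {r, s} \<and> {p, q} \<in> ?Q \<and> {q, r} \<in> ?Q"
      using path4_insertE[OF p[unfolded Q]] no by argo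
    then consider "f = {p, q}" "{q, r} \<in> ?Q" "{r, s} \<in> ?Q" | "f = {q, r}" "{p, q} \<in> ?Q" "{r, s} \<in> ?Q"
      | "f = {r, s}" "{p, q} \<in> ?Q" "{q, r} \<in> ?Q" by argo
    then have "c \<notin> {p, q, r, s} \<and>
      (\<forall>z. z \<notin> {p, q, r, s} \<longrightarrow> ({p, z} \<in> Q \<longrightarrow> {r, z} = {a, b}) \<and> ({q, z} \<in> Q \<longrightarrow> {s, z} = {a, b}))"
    proof cases
      case 1
      note f1 = fne[unfolded 1(1)]
      have "q \<noteq> s" using dist by simp
      from sub[OF 1(2,3) this] dist show ?thesis
        unfolding Q 1(1)
      proof (elim disjE conjE, goal_cases)
        case 1 then show ?case using f1 ne ends by (auto simp: doubleton_eq_iff)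
      next
        case 2 then show ?case using f1 ne ends by (auto simp: doubleton_eq_iff)
      next
        case 3 then show ?case using f1 ne ends by (auto simp: doubleton_eq_iff)
      next
        case 4 then show ?case using f1 ne ends by (auto simp: doubleton_eq_iff)
      qed
    next
      case 2
      note f1 = fne[unfolded 2(1)]
      have "v \<in> {b, y, t, a} \<and> w \<in> {b, y, t, a}" if "{v, w} \<in> ?Q" for v w
        using that by (auto simp: doubleton_eq_iff)
      from this[OF 2(2)] this[OF 2(3)] have "{p, q, r, s} \<subseteq> {b, y, t, a}" by simp
      moreover have "card {p, q, r, s} = 4" using dist by simp
      moreover have "card {b, y, t, a} = 4" using d(1) by simp
      ultimately have S: "{p, q, r, s} = {b, y, t, a}" by (intro card_seteq) simp_all
      have "\<Union>Q \<subseteq> {p, q, r, s}" unfolding Q 2(1) Union_insert using S by blast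
      then have "z \<in> {p, q, r, s}" if "{v, z} \<in> Q" for v z using that by blast
      moreover have "c \<notin> {p, q, r, s}" unfolding S using ne by auto
      ultimately show ?thesis by blast
    next
      case 3
      note f1 = fne[unfolded 3(1)]
      have "p \<noteq> r" using dist by simp
      from sub[OF 3(2,3) this] dist show ?thesis
        unfolding Q 3(1)
      proof (elim disjE conjE, goal_cases)
        case 1 then show ?case using f1 ne ends by (auto simp: doubleton_eq_iff)
      next
        case 2 then show ?case using f1 ne ends by (auto simp: doubleton_eq_iff)
      next
        case 3 then show ?case using f1 ne ends by (auto simp: doubleton_eq_iff)
      next
        case 4 then show ?case using f1 ne ends by (auto simp: doubleton_eq_iff)
      qed
    qed
    then show "c \<notin> {p, q, r, s}"
      "\<And>z. z \<notin> {p, q, r, s} \<Longrightarrow> {p, z} \<in> Q \<Longrightarrow> {r, z} \<in> ?P"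
      "\<And>z. z \<notin> {p, q, r, s} \<Longrightarrow> {q, z} \<in> Q \<Longrightarrow> {s, z} \<in> ?P" using \<open>{a, b} \<in> ?P\<close> by metis+
  qed
  have "wins (Suc 5) P Q"
  proof (rule wins_step[OF pos', of "{a, c}"])
    show "{a, c} \<in> E" using edge_in_V V by simp
    show "{a, c} \<notin> P" "{a, c} \<notin> Q"
      using V(5) d f(2) unfolding P Q by (auto simp: doubleton_eq_iff)
    fix g
    assume g: "g \<notin> P" "g \<noteq> {a, c}" and p4: "position (4 + j) ?P (insert g Q)"
    have "card (insert g Q) \<le> 5" using Q by (simp add: card_insert_if)
    then have "\<not> k23 (insert g Q)" using k23_card[of "insert g Q"] fin by auto
    moreover have "wins 5 ?P (insert g Q)"
    proof (rule attack[OF p4, of c b a u a])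
      show "safe ?P (insert g Q)"
      proof (rule safe_insert[OF no_c4])
        fix p q r s z
        assume p: "path4 Q p q r s" "g = {p, s}" and z: "z \<notin> {p, q, r, s}"
        have "{p, s} \<notin> ?P" using g p(2) by simp
        then show "{p, z} \<in> Q \<Longrightarrow> {r, z} \<in> ?P" "{q, z} \<in> Q \<Longrightarrow> {s, z} \<in> ?P"
          using path(2,3)[OF p(1) _ z] by simp_all
      qed
      show "\<not> on_c4 (insert g Q) c"
      proof (rule not_on_c4_insert[OF no_c4])
        fix p q r s
        assume p: "path4 Q p q r s" "g = {p, s}"
        have "{p, s} \<notin> ?P" using g p(2) by simp
        then show "c \<notin> {p, q, r, s}" by (rule path(1)[OF p(1)])
      qed
    qed (use V P in \<open>auto simp: edge_commute\<close>)
    ultimately show "\<not> k23 (insert g Q) \<and> wins 5 ?P (insert g Q)" ..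
  qed
  then show ?thesis by simp
qed

end

context k23_game begin

text \<open>The reply \<open>{a, c}\<close> extends the path of P2 to \<open>b y t a c\<close>, and P1 answers \<open>{c, y}\<close>, so that \<open>y t a c\<close> cannot
be closed either. Now \<open>{b, c}\<close> would make the 4-cycle \<open>a b c u\<close> with the pendant edge \<open>{c, y}\<close> and threaten
\<open>{a, y}\<close>, while \<open>{a, y}\<close> would make the 4-cycle \<open>a y c u\<close> with the additional edge \<open>{a, b}\<close>. P1 gets one of
the two. As \<open>u\<close> cannot lie on a 4-cycle of P2, and P1 owns every edge that P2 would need to exploit such
a cycle, the attack with forced replies at \<open>u\<close> works.\<close>
lemma bridge_blocked:
  assumes pos: "position (6 + j) P Q"
    and V: "u \<in> V" "a \<in> V" "b \<in> V" "c \<in> V" "y \<in> V" "distinct [u, a, b, c]"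
    and P: "P = {{u, a}, {u, b}, {u, c}, {a, b}}" and Q: "Q = {{b, y}, {y, t}, {t, a}, {a, c}}"
    and d: "distinct [b, y, t, a]" "u \<notin> {y, t}" "c \<notin> {y, t}"
  shows "wins 7 P Q"
proof -
  let ?P = "insert {c, y} P"
  have ne: "distinct [u, a, b, c, y, t]" using V(6) d by auto
  have E: "{c, y} \<in> E" "{b, c} \<in> E" "{a, y} \<in> E" using edge_in_V V(1-5) ne by auto
  have pos': "position (Suc (5 + j)) P Q" using pos by (simp add: numeral_eq_Suc)
  have fin: "finite Q" using pos by (simp add: position_def)
  have no_c4: "\<not> c4 Q p q r s" for p q r s
    using ne unfolding Q c4_def by (auto simp: doubleton_eq_iff)
  have path: "{p, s} \<in> {{a, b}, {c, y}}" if "path4 Q p q r s" for p q r s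
    using that ne unfolding Q path4_def by (auto simp: doubleton_eq_iff)

  let ?R = "insert {a, y} Q" and ?S = "insert {b, c} Q"
  let ?P' = "insert {b, c} ?P" and ?P'' = "insert {a, y} ?P"
  have R: "?R = {{a, y}, {b, y}, {y, t}, {t, a}, {a, c}}" unfolding Q by auto
  have S: "?S = {{b, c}, {b, y}, {y, t}, {t, a}, {a, c}}" unfolding Q by auto
  have R_c4: "\<not> c4 ?R p q r s" for p q r s
    using ne unfolding R c4_def by (auto simp: doubleton_eq_iff)
  have S_c4: "\<not> c4 ?S p q r s" for p q r s
    using ne unfolding S c4_def by (auto simp: doubleton_eq_iff)
  have R_path: "(p, q, r, s) \<in> {(b, y, a, t), (t, a, y, b), (c, a, y, t), (t, y, a, c)}"
    if "path4 ?R p q r s" "{p, s} \<noteq> {a, b}" "{p, s} \<noteq> {b, c}" "{p, s} \<noteq> {c, y}" for p q r s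
    using that ne unfolding R path4_def by (auto simp: doubleton_eq_iff)
  \<comment> \<open>\<open>?S\<close> is a 5-cycle, and three of its five chords belong to P1.\<close>
  have S_path: "(p, q, r, s) \<in> {(c, b, y, t), (t, y, b, c), (b, c, a, t), (t, a, c, b)}"
    if "path4 ?S p q r s" "{p, s} \<noteq> {a, b}" "{p, s} \<noteq> {a, y}" "{p, s} \<noteq> {c, y}" for p q r s
    using that ne unfolding S path4_def by (auto simp: doubleton_eq_iff)
  have final_R: "wins 5 ?P' (insert g ?R)"
    if p4: "position (4 + j) ?P' (insert g ?R)" and g: "g \<notin> ?P'" for g
  proof (rule attack[OF p4, of u b y c a])
    have gs: "(p, q, r, s) \<in> {(b, y, a, t), (t, a, y, b), (c, a, y, t), (t, y, a, c)}"
      if "path4 ?R p q r s" "g = {p, s}" for p q r s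
      using R_path[OF that(1)] that(2) g P by auto
    show "safe ?P' (insert g ?R)"
    proof (rule safe_insert[OF R_c4])
      fix p q r s z
      assume p: "path4 ?R p q r s" "g = {p, s}" and z: "z \<notin> {p, q, r, s}"
      show "{p, z} \<in> ?R \<Longrightarrow> {r, z} \<in> ?P'" "{q, z} \<in> ?R \<Longrightarrow> {s, z} \<in> ?P'"
        using gs[OF p] z ne unfolding R by (auto simp: doubleton_eq_iff)
    qed
    show "\<not> on_c4 (insert g ?R) u"
      by (rule not_on_c4_insert[OF R_c4]) (use gs ne in fastforce)
  qed (use V P ne in \<open>auto simp: edge_commute\<close>)
  have final_S: "wins 5 ?P'' (insert g ?S)"
    if p4: "position (4 + j) ?P'' (insert g ?S)" and g: "g \<notin> ?P''" for g
  proof (rule attack[OF p4, of u y b a c])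
    have gs: "(p, q, r, s) \<in> {(c, b, y, t), (t, y, b, c), (b, c, a, t), (t, a, c, b)}"
      if "path4 ?S p q r s" "g = {p, s}" for p q r s
      using S_path[OF that(1)] that(2) g P by auto
    show "safe ?P'' (insert g ?S)"
    proof (rule safe_insert[OF S_c4])
      fix p q r s z
      assume p: "path4 ?S p q r s" "g = {p, s}" and z: "z \<notin> {p, q, r, s}"
      show "{p, z} \<in> ?S \<Longrightarrow> {r, z} \<in> ?P''" "{q, z} \<in> ?S \<Longrightarrow> {s, z} \<in> ?P''"
        using gs[OF p] z ne P unfolding S by (auto simp: doubleton_eq_iff)
    qed
    show "\<not> on_c4 (insert g ?S) u"
      by (rule not_on_c4_insert[OF S_c4]) (use gs ne in fastforce)
  qed (use V P ne in \<open>auto simp: edge_commute\<close>)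

  have "wins (Suc 6) P Q"
  proof (rule wins_step[OF pos' E(1)])
    show "{c, y} \<notin> P" "{c, y} \<notin> Q" using ne unfolding P Q by (auto simp: doubleton_eq_iff)
    fix f let ?Q = "insert f Q"
    assume f: "f \<in> E" "f \<notin> P" "f \<notin> Q" "f \<noteq> {c, y}" and p5: "position (5 + j) ?P ?Q"
    have p5': "position (Suc (4 + j)) ?P ?Q" using p5 by (simp add: numeral_eq_Suc)
    have "{a, b} \<in> P" using P by simp
    then have no_path: "f \<noteq> {p, s}" if "path4 Q p q r s" for p q r s
      using path[OF that] f(2,4) by (metis insertE singletonD)
    have "\<not> c4 ?Q p q r s" for p q r s
    proof
      assume c: "c4 ?Q p q r s"
      then show False by (rule c4_insertE[OF _ no_c4]) (use no_path in blast)
    qed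
    then have safe: "safe ?P ?Q" by (rule safe_if_no_c4)
    have no: "\<not> k23 (insert g ?Q)" if "g \<notin> ?P" for g
      using safe_no_reply[OF p5 safe that] .
    have not_bc: "{b, c} \<notin> ?P" and not_ay: "{a, y} \<notin> ?P" "{a, y} \<notin> Q"
      and bc_ay: "{b, c} \<noteq> {a, y}" and bc_Q: "{b, c} \<notin> Q"
      using ne unfolding P Q by (auto simp: doubleton_eq_iff)
    have "wins (Suc 5) ?P ?Q"
    proof (cases "f = {b, c}")
      case True
      show ?thesis
      proof (rule wins_step[OF p5' E(3) not_ay(1)])
        show "{a, y} \<notin> ?Q" using not_ay(2) bc_ay True by auto
        fix g assume "g \<notin> ?P" "g \<noteq> {a, y}" "position (4 + j) ?P'' (insert g ?Q)"
        then show "\<not> k23 (insert g ?Q) \<and> wins 5 ?P'' (insert g ?Q)"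
          using no final_S[of g] True by simp
      qed
    next
      case False
      then have bc_Q': "{b, c} \<notin> ?Q" using bc_Q by simp
      show ?thesis
      proof (cases "f = {a, y}")
        case True
        show ?thesis
        proof (rule wins_step[OF p5' E(2) not_bc bc_Q'])
          fix g assume "g \<notin> ?P" "g \<noteq> {b, c}" "position (4 + j) ?P' (insert g ?Q)"
          then show "\<not> k23 (insert g ?Q) \<and> wins 5 ?P' (insert g ?Q)"
            using no final_R[of g] True by simp
        qed
      next
        case nay: False
        show ?thesis
        proof (rule wins_force[OF p5' E(2) not_bc bc_Q' E(3) not_ay(1)])
          show "k23 (insert {a, y} ?P')"
            by (rule k23_I[of a c b u y]) (use ne P in \<open>auto simp: edge_commute\<close>)
          assume "position (4 + j) ?P' (insert {a, y} ?Q)"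
          then show "wins 5 ?P' (insert {a, y} ?Q)"
            using final_R[of f] f False by (simp add: insert_commute[of "{a, y}" f])
        qed (use no nay not_ay bc_ay in auto)
      qed
    qed
    then show "\<not> k23 ?Q \<and> wins 6 ?P ?Q"
      using safe_not_k23[OF safe] p5 by (simp add: position_def)
  qed
  then show ?thesis by simp
qed

end

context k23_game begin

text \<open>P1 bridges the path of P2 by \<open>{a, b}\<close>. The reflection that exchanges \<open>a\<close> with \<open>b\<close> and \<open>y\<close> with \<open>t\<close> turns the
reply \<open>{b, c}\<close> into \<open>{a, c}\<close>, and \<open>{c, t}\<close> into the harmless \<open>{c, y}\<close>.\<close>
lemma bridge:
  assumes pos: "position (7 + j) P Q"
    and V: "u \<in> V" "a \<in> V" "b \<in> V" "c \<in> V" "distinct [u, a, b, c]"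
    and P: "P = {{u, a}, {u, b}, {u, c}}" and path: "path4 Q b y t a" and Q3: "card Q \<le> 3"
    and c: "c \<notin> {y, t}"
  shows "wins 8 P Q"
proof -
  have fin: "finite Q" and disj: "P \<inter> Q = {}" and QE: "Q \<subseteq> E" using pos by (auto simp: position_def)
  have Q: "Q = {{b, y}, {y, t}, {t, a}}" by (rule path4_set[OF path fin Q3])
  have d: "distinct [b, y, t, a]" using path by (simp add: path4_def)
  have "{u, a} \<notin> Q" "{u, b} \<notin> Q" using disj P by blast+
  then have u: "u \<notin> {y, t}" unfolding Q by (auto simp: edge_commute)
  have yt: "y \<in> V" "t \<in> V"
    using edge_closed[of b y, OF _ V(3)] edge_closed[of a t, OF _ V(2)] QE edge_commute[of a t]
    unfolding Q by simp_all
  let ?P = "insert {a, b} P"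
  have P': "?P = {{u, a}, {u, b}, {u, c}, {a, b}}" "?P = {{u, b}, {u, a}, {u, c}, {b, a}}"
    using P by auto
  have pos': "position (Suc (6 + j)) P Q" using pos by (simp add: numeral_eq_Suc)
  have "wins (Suc 7) P Q"
  proof (rule wins_step[OF pos'])
    show "{a, b} \<in> E" using edge_in_V V by auto
    show "{a, b} \<notin> P" "{a, b} \<notin> Q" using V(5) d unfolding P Q by (auto simp: doubleton_eq_iff)
    fix f assume f: "f \<in> E" "f \<notin> P" "f \<noteq> {a, b}" and p: "position (6 + j) ?P (insert f Q)"
    have fP: "f \<notin> ?P" using f by simp
    have p5: "position (5 + j) ?P (insert f Q)" using position_weaken[of 1] p by simp
    have "wins 7 ?P (insert f Q)"
    proof -
      consider "f = {a, c}" | "f = {b, c}" | "f = {c, t}" | "f \<noteq> {a, c}" "f \<noteq> {b, c}" "f \<noteq> {c, t}" by argo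
      then show ?thesis
      proof cases
        case 1
        have Q': "insert f Q = {{b, y}, {y, t}, {t, a}, {a, c}}" using Q 1 by auto
        show ?thesis by (rule bridge_blocked[OF p V(1-4) yt(1) V(5) P'(1) Q' d u c])
      next
        case 2
        have Q': "insert f Q = {{a, t}, {t, y}, {y, b}, {b, c}}" using Q 2 by auto
        show ?thesis
          by (rule bridge_blocked[OF p V(1,3,2,4) yt(2) _ P'(2) Q']) (use V(5) d u c in auto)
      next
        case 3
        have Q': "insert f Q = insert f {{a, t}, {t, y}, {y, b}}" using Q by auto
        have "wins 6 ?P (insert f Q)"
        proof (rule bridge_free[OF p5 V(1,3,2,4) _ P'(2) Q'])
          show "f \<notin> {{b, c}, {a, c}, {c, y}}" using 3 V(5) d c by (auto simp: doubleton_eq_iff)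
        qed (use V(5) d u c fP in auto)
        then show ?thesis by (rule forced_win_mono) simp
      next
        case 4
        have Q': "insert f Q = insert f {{b, y}, {y, t}, {t, a}}" using Q by auto
        have "wins 6 ?P (insert f Q)"
          by (rule bridge_free[OF p5 V P'(1) Q' d u c fP]) (simp add: 4)
        then show ?thesis by (rule forced_win_mono) simp
      qed
    qed
    moreover have "card (insert f Q) \<le> 4" using card_insert_le_Suc[OF Q3, of f] by simp
    then have "\<not> k23 (insert f Q)" using k23_card[of "insert f Q"] fin by auto
    ultimately show "\<not> k23 (insert f Q) \<and> wins 7 ?P (insert f Q)" by blast
  qed
  then show ?thesis by simp
qed

text \<open>The three edges of P2 form the path \<open>p q r s\<close>, and one of them, \<open>f\<close>, contains no leaf of P1. So if two
leaves lie on the path, they are the vertices outside \<open>f\<close>: either the first two or the last two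
vertices, or the two ends.\<close>
lemma star_open_path:
  assumes pos: "position (7 + j) P Q" and Q3: "card Q \<le> 3"
    and V: "u \<in> V" "a \<in> V" "b \<in> V" "c \<in> V" "distinct [u, a, b, c]"
    and P: "P = {{u, a}, {u, b}, {u, c}}"
    and first: "f \<in> Q" "f \<inter> {a, b, c} = {}"
    and path: "path4 Q p q r s" and op: "{p, s} \<notin> P"
  shows "wins 8 P Q"
proof -
  have fin: "finite Q" and disj: "P \<inter> Q = {}" and QE: "Q \<subseteq> E" using pos by (auto simp: position_def)
  have Q: "Q = {{p, q}, {q, r}, {r, s}}" by (rule path4_set[OF path fin Q3])
  have d: "distinct [p, q, r, s]" using path by (simp add: path4_def)
  have pos6: "position (6 + j) P Q" using position_weaken[of 1] pos by simp
  have leaf_V: "v \<in> V" "v \<noteq> u" if "v \<in> {a, b, c}" for v using V that by auto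
  have third: "\<exists>k. {k, l, m} = {a, b, c} \<and> distinct [u, l, m, k] \<and> k \<in> V \<and> P = {{u, l}, {u, m}, {u, k}}"
    if "l \<in> {a, b, c}" "m \<in> {a, b, c}" "l \<noteq> m" for l m
  proof -
    have "card ({a, b, c} - {l, m}) = card {a, b, c} - card {l, m}"
      using that by (intro card_Diff_subset) auto
    also have "\<dots> = 1" using V(5) \<open>l \<noteq> m\<close> by simp
    finally obtain k where "{a, b, c} - {l, m} = {k}" by (rule card_1_singletonE)
    then have k: "{k, l, m} = {a, b, c}" "k \<in> {a, b, c}" "k \<notin> {l, m}" using that(1,2) by blast+
    have "P = (\<lambda>v. {u, v}) ` {a, b, c}" using P by simp
    also have "\<dots> = {{u, l}, {u, m}, {u, k}}" unfolding k(1)[symmetric] by auto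
    finally show ?thesis
      using k leaf_V(1)[OF k(2)] leaf_V(2)[OF k(2)] leaf_V(2)[OF that(1)] leaf_V(2)[OF that(2)] that(3)
      by (intro exI[of _ k]) auto
  qed
  have two_leaves: "wins 8 P Q"
    if Q': "Q = {{g, h}, {h, y}, {y, x}}" and gh: "g \<in> {a, b, c}" "h \<in> {a, b, c}"
      and yx: "y \<notin> {a, b, c}" "x \<notin> {a, b, c}" and p: "path4 Q g h y x" and op: "{x, g} \<notin> P" for g h y x
  proof -
    have gne: "g \<noteq> h" using p by (auto simp: path4_def)
    from third[OF gh gne] obtain k where k: "{k, g, h} = {a, b, c}" "distinct [u, g, h, k]" "k \<in> V"
      "P = {{u, g}, {u, h}, {u, k}}" by blast
    have "k \<in> {a, b, c}" unfolding k(1)[symmetric] by simp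
    then have kn: "k \<noteq> x" "k \<noteq> y" using yx by auto
    have "y \<in> V" using edge_closed[of h y] QE Q' leaf_V[OF gh(2)] by auto
    then have xV: "x \<in> V" using edge_closed[of y x] QE Q' by auto
    have "x \<noteq> u" using op k(4) by auto
    moreover have "x \<noteq> g" "x \<noteq> h" using p by (auto simp: path4_def)
    ultimately have "distinct [u, g, h, k, x]" using k(2) kn by auto
    then have "wins 7 P Q"
      by (rule path_from_two_leaves[OF pos6 V(1) leaf_V(1)[OF gh(1)] leaf_V(1)[OF gh(2)] k(3) xV _ k(4) Q' p kn(2)])
    then show ?thesis by (rule forced_win_mono) simp
  qed
  show ?thesis
  proof (cases "\<exists>l m. l \<noteq> m \<and> l \<in> {a, b, c} \<and> m \<in> {a, b, c} \<and> l \<in> {p, q, r, s} \<and> m \<in> {p, q, r, s}")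
    case True
    then obtain l m where lm: "l \<noteq> m" "l \<in> {a, b, c}" "m \<in> {a, b, c}" "l \<in> {p, q, r, s}" "m \<in> {p, q, r, s}"
      by blast
    have nf: "v \<notin> {a, b, c}" if "v \<in> f" for v using first(2) that by blast
    have "f = {p, q} \<or> f = {q, r} \<or> f = {r, s}" using first(1) unfolding Q by simp
    then show ?thesis
    proof (elim disjE)
      assume f: "f = {p, q}"
      have "p \<notin> {a, b, c}" "q \<notin> {a, b, c}" using nf f by simp_all
      then have "r \<in> {a, b, c}" "s \<in> {a, b, c}" using lm by (metis insertE singletonD)+
      then show ?thesis
        using two_leaves[of s r q p] nf f path4_reverse[OF path] op Q
        by (simp add: edge_commute insert_commute)
    next
      assume f: "f = {r, s}"
      have "r \<notin> {a, b, c}" "s \<notin> {a, b, c}" using nf f by simp_all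
      then have "p \<in> {a, b, c}" "q \<in> {a, b, c}" using lm by (metis insertE singletonD)+
      then show ?thesis
        using two_leaves[of p q r s] nf f path op Q by (simp add: edge_commute)
    next
      assume f: "f = {q, r}"
      have qr: "q \<notin> {a, b, c}" "r \<notin> {a, b, c}" using nf f by simp_all
      then have ps: "p \<in> {a, b, c}" "s \<in> {a, b, c}" using lm by (metis insertE singletonD)+
      have "s \<noteq> p" using d by auto
      from third[OF ps(2,1) this] obtain k where k: "{k, s, p} = {a, b, c}" "distinct [u, s, p, k]" "k \<in> V"
        "P = {{u, s}, {u, p}, {u, k}}" by blast
      have "k \<in> {a, b, c}" unfolding k(1)[symmetric] by simp
      then have "k \<notin> {q, r}" using qr by auto
      then show ?thesis
        by (rule bridge[OF pos V(1) leaf_V(1)[OF ps(2)] leaf_V(1)[OF ps(1)] k(3,2,4) path Q3])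
    qed
  next
    case False
    have untouched: "wins 8 P Q" if "P = {{u, l}, {u, m}, {u, m'}}" "distinct [u, l, m, m']"
      "l \<in> V" "m \<in> V" "m' \<in> V" "m \<notin> {p, q, r, s}" "m' \<notin> {p, q, r, s}" for l m m'
    proof -
      have "m \<notin> e \<and> m' \<notin> e" if "e \<in> Q" for e using that \<open>m \<notin> _\<close> \<open>m' \<notin> _\<close> unfolding Q by auto
      then have "wins 7 P Q"
        by (rule spider_untouched[OF pos6 Q3 V(1) that(3,4,5,2,1)])
      then show ?thesis by (rule forced_win_mono) simp
    qed
    have pair: "l \<notin> {p, q, r, s} \<or> m \<notin> {p, q, r, s}" if "l \<noteq> m" "l \<in> {a, b, c}" "m \<in> {a, b, c}" for l m
      using False that by metis
    have "a \<notin> {p, q, r, s} \<and> b \<notin> {p, q, r, s} \<or> a \<notin> {p, q, r, s} \<and> c \<notin> {p, q, r, s}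
       \<or> b \<notin> {p, q, r, s} \<and> c \<notin> {p, q, r, s}"
      using pair[of a b] pair[of a c] pair[of b c] V(5) by simp metis
    then show ?thesis
    proof (elim disjE conjE)
      assume "a \<notin> {p, q, r, s}" "b \<notin> {p, q, r, s}"
      then show ?thesis by (intro untouched[of c a b]) (use V P in auto)
    next
      assume "a \<notin> {p, q, r, s}" "c \<notin> {p, q, r, s}"
      then show ?thesis by (intro untouched[of b a c]) (use V P in auto)
    next
      assume "b \<notin> {p, q, r, s}" "c \<notin> {p, q, r, s}"
      then show ?thesis by (intro untouched[of a b c]) (use V P in auto)
    qed
  qed
qed

lemma star:
  assumes pos: "position (7 + j) P Q" and Q3: "card Q \<le> 3"
    and V: "u \<in> V" "a \<in> V" "b \<in> V" "c \<in> V" "distinct [u, a, b, c]"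
    and P: "P = {{u, a}, {u, b}, {u, c}}"
    and first: "f \<in> Q" "f \<inter> {a, b, c} = {}"
  shows "wins 8 P Q"
proof (cases "\<forall>p q r s. path4 Q p q r s \<longrightarrow> {p, s} \<in> P")
  case True
  have "position (6 + j) P Q" using position_weaken[of 1] pos by simp
  then have "wins 7 P Q" by (rule star_closed_paths[OF _ Q3 V P]) (use True in blast)
  then show ?thesis by (rule forced_win_mono) simp
next
  case False
  then obtain p q r s where "path4 Q p q r s" "{p, s} \<notin> P" by blast
  then show ?thesis by (rule star_open_path[OF pos Q3 V P first])
qed

text \<open>P1 builds the star out of edges to new vertices. One end of the first edge is missed by P2's first
edge; it becomes a leaf and the other end becomes the centre, so that P2's first edge contains no leaf.\<close>
lemma wins_from_start:
  assumes "42 \<le> card V"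
  shows "wins 11 {} {}"
proof -
  \<comment> \<open>Ten rounds may be played before P1's last move, whence \<open>4 * 10 + 2\<close> vertices.\<close>
  have pos0: "position (Suc 9) {} {}" using assms by (simp add: position_def)
  have few: "\<not> k23 F" if "card F \<le> 3" "finite F" for F
    using k23_card[OF _ that(2)] that(1) by auto
  have finV: "finite V" using assms by (metis card.infinite not_numeral_le_zero)
  obtain x where x: "x \<in> V" using assms by (metis card.empty ex_in_conv not_numeral_le_zero)
  obtain x' where x': "x' \<in> V" "x' \<noteq> x"
  proof -
    have "V \<noteq> {x}" using assms by auto
    with x that show thesis by blast
  qed
  have "wins (Suc 10) {} {}"
  proof (rule wins_step[OF pos0, of "{x, x'}"])
    show "{x, x'} \<in> E" using edge_in_V x x' by simp
    fix f assume f: "f \<in> E" "f \<notin> {}" "f \<noteq> {x, x'}" and p1: "position 9 {{x, x'}} {f}"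
    have "card f = 2" using card_edge f by simp
    then have "\<not> {x, x'} \<subseteq> f" using f(3) x' card_seteq[of f "{x, x'}"] by (auto simp: card_2_iff)
    \<comment> \<open>\<open>u\<close> will be the centre of the star.\<close>
    then obtain u a where ua: "{x, x'} = {u, a}" "a \<notin> f" "u \<in> V" "a \<in> V" "u \<noteq> a"
      using x x' by (metis insert_commute insert_subset empty_subsetI)
    have "wins (Suc 9) {{u, a}} {f}"
    proof -
      have p1': "position (Suc 8) {{u, a}} {f}" using p1 ua(1) by simp
      obtain b where b: "b \<in> V" "b \<notin> {u, a}" "b \<notin> f" using position_fresh[OF p1'] by auto
      show ?thesis
      proof (rule wins_step[OF p1', of "{u, b}"])
        show "{u, b} \<in> E" using edge_in_V ua b by auto
        show "{u, b} \<notin> {{u, a}}" using b by (auto simp: doubleton_eq_iff)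
        show "{u, b} \<notin> {f}" using b by auto
        fix g assume p2: "position 8 (insert {u, b} {{u, a}}) (insert g {f})"
        then have p2': "position (Suc (7 + 0)) {{u, b}, {u, a}} {g, f}" by simp
        obtain c where cV: "c \<in> V" and cP: "\<And>e. e \<in> {{u, b}, {u, a}} \<Longrightarrow> c \<notin> e"
          and cQ: "\<And>e. e \<in> {g, f} \<Longrightarrow> c \<notin> e"
          using position_fresh[OF p2'] by blast
        have c: "c \<in> V" "c \<notin> {u, a}" "c \<notin> {u, b}" "c \<notin> f" "c \<notin> g"
          using cV cP[of "{u, a}"] cP[of "{u, b}"] cQ[of f] cQ[of g] by simp_all
        have "wins (Suc 8) {{u, b}, {u, a}} {g, f}"
        proof (rule wins_step[OF p2', of "{u, c}"])
          show "{u, c} \<in> E" using edge_in_V ua c by auto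
          show "{u, c} \<notin> {{u, b}, {u, a}}" using c by (auto simp: doubleton_eq_iff)
          show "{u, c} \<notin> {g, f}" using c by auto
          fix h assume p3: "position (7 + 0) (insert {u, c} {{u, b}, {u, a}}) (insert h {g, f})"
          have c3: "card {h, g, f} \<le> 3" by (simp add: card_insert_if)
          have "wins 8 (insert {u, c} {{u, b}, {u, a}}) (insert h {g, f})"
          proof (rule star[OF p3 c3])
            show "u \<in> V" "a \<in> V" "b \<in> V" "c \<in> V" using ua b c by auto
            show "distinct [u, a, b, c]" using ua b c by auto
            show "insert {u, c} {{u, b}, {u, a}} = {{u, a}, {u, b}, {u, c}}" by auto
            show "f \<in> {h, g, f}" by simp
            show "f \<inter> {a, b, c} = {}" using ua b c by auto
          qed
          then show "\<not> k23 (insert h {g, f}) \<and> wins 8 (insert {u, c} {{u, b}, {u, a}}) (insert h {g, f})"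
            using few[OF c3] by simp
        qed
        then show "\<not> k23 (insert g {f}) \<and> wins 9 (insert {u, b} {{u, a}}) (insert g {f})"
          using few[of "{g, f}"] by (simp add: card_insert_if)
      qed
    qed
    then show "\<not> k23 (insert f {}) \<and> wins 10 (insert {x, x'} {}) (insert f {})"
      using few[of "{f}"] ua(1) by simp
  qed simp_all
  then show ?thesis by simp
qed

end

section \<open>Paths and cycles as vertex lists\<close>

fun path_edges :: "'a list \<Rightarrow> 'a set set" where
  "path_edges (x # y # zs) = insert {x, y} (path_edges (y # zs))"
| "path_edges _ = {}"

lemma path_edges_append:
  "xs \<noteq> [] \<Longrightarrow> ys \<noteq> [] \<Longrightarrow>
    path_edges (xs @ ys) = insert {last xs, hd ys} (path_edges xs \<union> path_edges ys)"
proof (induction xs rule: path_edges.induct)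
  case ("2_2" x)
  then show ?case by (cases ys) auto
qed auto

lemma path_edges_rev: "path_edges (rev xs) = path_edges xs"
proof (induction xs rule: path_edges.induct)
  case (1 x y zs)
  then show ?case using path_edges_append[of "rev (y # zs)" "[x]"] by (auto simp: insert_commute)
qed auto

lemma path_edges_subset: "e \<in> path_edges xs \<Longrightarrow> e \<subseteq> set xs"
  by (induction xs rule: path_edges.induct) auto

lemma path_edges_cover: "2 \<le> length xs \<Longrightarrow> \<Union>(path_edges xs) = set xs"
proof (induction xs rule: path_edges.induct)
  case (1 x y zs)
  then show ?case by (cases zs) auto
qed auto

lemma finite_path_edges: "finite (path_edges xs)"
  by (induction xs rule: path_edges.induct) auto

lemma card_path_edges: "distinct xs \<Longrightarrow> card (path_edges xs) = length xs - 1"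
proof (induction xs rule: path_edges.induct)
  case (1 x y zs)
  then have "{x, y} \<notin> path_edges (y # zs)" using path_edges_subset[of "{x, y}" "y # zs"] by auto
  with 1 show ?case by (simp add: finite_path_edges)
qed auto

lemma path_edges_nth: "path_edges xs = {{xs ! i, xs ! Suc i} | i. Suc i < length xs}"
proof (induction xs rule: path_edges.induct)
  case (1 x y zs)
  have "{{(x # y # zs) ! i, (x # y # zs) ! Suc i} | i. Suc i < length (x # y # zs)} =
    insert {x, y} {{(y # zs) ! i, (y # zs) ! Suc i} | i. Suc i < length (y # zs)}" (is "?A = insert _ ?B")
  proof (intro set_eqI iffI)
    fix e assume "e \<in> ?A"
    then obtain i where "e = {(x # y # zs) ! i, (x # y # zs) ! Suc i}" "Suc i < length (x # y # zs)" by blast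
    then show "e \<in> insert {x, y} ?B" by (cases i) auto
  next
    fix e assume "e \<in> insert {x, y} ?B"
    then consider "e = {x, y}" | i where "e = {(y # zs) ! i, (y # zs) ! Suc i}" "Suc i < length (y # zs)" by blast
    then show "e \<in> ?A"
    proof cases
      case 1
      then show ?thesis by (intro CollectI exI[of _ 0]) simp
    next
      case 2
      then show ?thesis by (intro CollectI exI[of _ "Suc i"]) simp
    qed
  qed
  with 1 show ?case by simp
qed auto

definition path_in :: "'a set set \<Rightarrow> 'a list \<Rightarrow> bool" where
  "path_in F xs \<longleftrightarrow> distinct xs \<and> path_edges xs \<subseteq> F"

definition cycle_in :: "'a set set \<Rightarrow> 'a list \<Rightarrow> bool" where
  "cycle_in F xs \<longleftrightarrow> path_in F xs \<and> xs \<noteq> [] \<and> {last xs, hd xs} \<in> F"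

definition has_cycle :: "nat \<Rightarrow> 'a set set \<Rightarrow> bool" where
  "has_cycle l F \<longleftrightarrow> (\<exists>xs. length xs = l \<and> cycle_in F xs)"

lemma cycle_in_rotate: "cycle_in F (xs @ ys) \<Longrightarrow> cycle_in F (ys @ xs)"
  by (cases "xs = []"; cases "ys = []") (auto simp: cycle_in_def path_in_def path_edges_append)

lemma cycle_in_rev: "cycle_in F xs \<Longrightarrow> cycle_in F (rev xs)"
  by (auto simp: cycle_in_def path_in_def path_edges_rev hd_rev last_rev insert_commute)

lemma cycle_in_card:
  assumes "cycle_in F xs" "3 \<le> length xs" "finite F"
  shows "length xs \<le> card F"
proof -
  have d: "distinct xs" and ne: "xs \<noteq> []" using assms by (auto simp: cycle_in_def path_in_def)
  obtain x ys where xs: "xs = x # ys" "2 \<le> length ys" using assms(2) by (cases xs) auto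
  then have "ys \<noteq> []" by auto
  have "{last xs, hd xs} \<notin> path_edges xs"
  proof
    assume "{last xs, hd xs} \<in> path_edges xs"
    moreover have "path_edges xs = insert {x, hd ys} (path_edges ys)"
      using path_edges_append[of "[x]" ys] xs(1) \<open>ys \<noteq> []\<close> by simp
    moreover have "{last xs, hd xs} \<notin> path_edges ys"
      using path_edges_subset[of "{last xs, hd xs}" ys] xs d by auto
    ultimately have "{last xs, hd xs} = {x, hd ys}" by simp
    then have "{last ys, x} = {x, hd ys}" using xs(1) \<open>ys \<noteq> []\<close> by simp
    then have "last ys = hd ys" by (auto simp: doubleton_eq_iff)
    moreover obtain y z zs where "ys = y # z # zs" using xs(2) by (cases ys; cases "tl ys") auto
    ultimately show False using xs(1) d by (auto split: if_splits)
  qed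
  then have "card (insert {last xs, hd xs} (path_edges xs)) = length xs"
    using card_path_edges[OF d] ne by (simp add: finite_path_edges)
  moreover have "insert {last xs, hd xs} (path_edges xs) \<subseteq> F"
    using assms(1) by (auto simp: cycle_in_def path_in_def)
  ultimately show ?thesis using card_mono[OF assms(3)] by metis
qed

lemma path_in_fresh:
  assumes "path_in F xs" "2 \<le> length xs" "\<And>e. e \<in> F \<Longrightarrow> v \<notin> e"
  shows "v \<notin> set xs"
  unfolding path_edges_cover[OF assms(2), symmetric] using assms(1,3) by (auto simp: path_in_def)

lemma path_in_pendant_last:
  assumes "path_in F ys" "y \<in> set ys" "hd ys \<noteq> y"
    and pendant: "\<And>v. {v, y} \<in> F \<Longrightarrow> v = x"
  obtains as where "ys = as @ [y]" "as \<noteq> []" "last as = x" "y \<notin> set as"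
proof -
  obtain as bs where ys: "ys = as @ y # bs" using assms(2) by (meson split_list)
  have as: "as \<noteq> []" using ys assms(3) by auto
  have d: "distinct ys" and sub: "path_edges ys \<subseteq> F" using assms(1) by (auto simp: path_in_def)
  have e: "{last as, y} \<in> F" "path_edges (y # bs) \<subseteq> F" using sub as unfolding ys by (auto simp: path_edges_append)
  have "bs = []"
  proof (cases bs)
    case (Cons b bs')
    then have "{b, y} \<in> F" using e(2) by (auto simp: insert_commute)
    then have "b = last as" using pendant e(1) by blast
    then show ?thesis using d as Cons unfolding ys by auto
  qed
  then show thesis using that[of as] ys as pendant[OF e(1)] d by auto
qed

section \<open>Paths of the opponent in the cycle game\<close>

text \<open>Besides its free edges \<open>Q\<close>, P2 owns pendant edges from \<open>x\<close> to vertices of \<open>Y\<close>. Without them there are too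
few edges for a cycle. A cycle through \<open>y \<in> Y\<close> consists of \<open>{x, y}\<close>, the new edge \<open>f\<close> at \<open>y\<close>, and a path that
starts at \<open>x\<close>; unless it is the triangle on \<open>x\<close> and two vertices of \<open>Y\<close>, this path lies in \<open>Q\<close>,
where there is none of this length.\<close>
lemma no_cycle_through_pendants:
  assumes l: "3 \<le> l" and fin: "finite Q" and card: "card Q + 2 \<le> l"
    and no_path: "\<And>ys. \<lbrakk>path_in Q ys; length ys + 1 = l\<rbrakk> \<Longrightarrow> hd ys \<noteq> x"
    and Y: "\<And>e y. e \<in> Q \<Longrightarrow> y \<in> Y \<Longrightarrow> y \<notin> e" "x \<notin> Y"
    and triangle: "l = 3 \<Longrightarrow> \<exists>y0. Y \<subseteq> {y0}"
  shows "\<not> has_cycle l (insert f (Q \<union> (\<lambda>y. {x, y}) ` Y))"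
proof
  let ?Q = "Q \<union> (\<lambda>y. {x, y}) ` Y"
  assume "has_cycle l (insert f ?Q)"
  then obtain cs where cs: "length cs = l" "cycle_in (insert f ?Q) cs" by (auto simp: has_cycle_def)
  have pendant: "v = x" if "{v, y} \<in> ?Q" "y \<in> Y" for v y
    using that Y by (auto simp: doubleton_eq_iff)
  show False
  proof (cases "set cs \<inter> Y = {}")
    case True
    have "cycle_in (insert f Q) cs"
    proof -
      have keep: "e \<in> insert f Q" if "e \<in> insert f ?Q" "e \<subseteq> set cs" for e
      proof (cases "e \<in> (\<lambda>y. {x, y}) ` Y")
        case True
        then obtain y where "y \<in> Y" "y \<in> e" by auto
        then show ?thesis using that(2) \<open>set cs \<inter> Y = {}\<close> by blast
      next
        case False
        then show ?thesis using that(1) by simp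
      qed
      have "cs \<noteq> []" and sub: "path_edges cs \<subseteq> insert f ?Q" "{last cs, hd cs} \<in> insert f ?Q"
        and d: "distinct cs" using cs(2) by (auto simp: cycle_in_def path_in_def)
      have "path_edges cs \<subseteq> insert f Q" 
        using keep[OF subsetD[OF sub(1)] path_edges_subset] by auto
      moreover have "{last cs, hd cs} \<in> insert f Q" using keep[OF sub(2)] \<open>cs \<noteq> []\<close> by simp
      ultimately show ?thesis using d \<open>cs \<noteq> []\<close> by (simp add: cycle_in_def path_in_def)
    qed
    then have "l \<le> card (insert f Q)" using cycle_in_card cs(1) l fin by blast
    moreover have "card (insert f Q) \<le> card Q + 1" using card_insert_le_m1[of "card Q + 1" Q f] by simp
    ultimately show False using card by simp
  next
    case False
    then obtain y where y: "y \<in> set cs" "y \<in> Y" by auto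
    obtain as bs where "cs = as @ y # bs" using y(1) by (meson split_list)
    then have rot: "cycle_in (insert f ?Q) (y # bs @ as)" "length (bs @ as) + 1 = l"
      using cycle_in_rotate[of _ as "y # bs"] cs by auto
    \<comment> \<open>One of the two cycle edges at \<open>y\<close> is the pendant edge; the cycle is traversed in that direction.\<close>
    have "\<exists>ys. cycle_in (insert f ?Q) (y # ys) \<and> length ys + 1 = l \<and> hd ys = x"
    proof -
      define ys where "ys = bs @ as"
      have c: "cycle_in (insert f ?Q) (y # ys)" and len: "length ys + 1 = l" using rot ys_def by auto
      have ne: "ys \<noteq> []" "hd ys \<noteq> last ys"
        using len l c by (cases ys; auto simp: cycle_in_def path_in_def split: if_splits)+
      have e: "{hd ys, y} \<in> insert f ?Q" "{last ys, y} \<in> insert f ?Q"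
        using c ne path_edges_append[of "[y]" ys] by (auto simp: cycle_in_def path_in_def insert_commute)
      show ?thesis
      proof (cases "hd ys = x")
        case True
        then show ?thesis using c len by blast
      next
        case False
        then have "{hd ys, y} = f" using e(1) pendant y(2) by blast
        then have "{last ys, y} \<noteq> f" using ne(2) by (auto simp: doubleton_eq_iff)
        then have "last ys = x" using e(2) pendant y(2) by blast
        moreover have "cycle_in (insert f ?Q) (y # rev ys)"
          using cycle_in_rotate[of _ "rev ys" "[y]"] cycle_in_rev[OF c] by simp
        ultimately show ?thesis using len ne by (intro exI[of _ "rev ys"]) (simp add: hd_rev)
      qed
    qed
    then obtain ys where c: "cycle_in (insert f ?Q) (y # ys)" and len: "length ys + 1 = l" and hd: "hd ys = x"
      by blast
    have ne: "ys \<noteq> []" "hd ys \<noteq> last ys" and d: "distinct (y # ys)"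
      using len l c by (cases ys; auto simp: cycle_in_def path_in_def split: if_splits)+
    have e: "{last ys, y} \<in> insert f ?Q" "path_edges ys \<subseteq> insert f ?Q"
      using c ne path_edges_append[of "[y]" ys] by (auto simp: cycle_in_def path_in_def)
    have "{last ys, y} \<notin> ?Q" using pendant[OF _ y(2), of "last ys"] ne(2) hd by metis
    then have f: "f = {last ys, y}" using e(1) by (metis insertE)
    then have "f \<notin> path_edges ys" using path_edges_subset[of f ys] d by auto
    then have p: "path_in ?Q ys" using e(2) d by (auto simp: path_in_def)
    have "set ys \<inter> Y = {}"
    proof (rule ccontr)
      assume "set ys \<inter> Y \<noteq> {}"
      then obtain y' where y': "y' \<in> set ys" "y' \<in> Y" by auto
      have "hd ys \<noteq> y'" using hd y'(2) Y(2) by auto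
      from path_in_pendant_last[OF p y'(1) this pendant[OF _ y'(2)]]
      obtain as where as: "ys = as @ [y']" "as \<noteq> []" "last as = x" by blast
      have "hd as = last as" using as hd by auto
      \<comment> \<open>So \<open>ys\<close> is the single edge \<open>{x, y'}\<close> and the cycle is a triangle.\<close>
      then have "as = [x]" using as d by (cases as) (auto split: if_splits)
      then have "l = 3" using as len by simp
      then show False using triangle y y' d by auto
    qed
    then have "e \<notin> (\<lambda>y. {x, y}) ` Y" if "e \<in> path_edges ys" for e
      using path_edges_subset[OF that] by auto
    then have "path_edges ys \<subseteq> Q" using p unfolding path_in_def by blast
    then have "path_in Q ys" using d by (simp add: path_in_def)
    then show False using no_path len hd by blast
  qed
qed

text \<open>P1 has extended its path by a new vertex \<open>v\<close>, and P2 has played \<open>f\<close>. If P2 had paths with \<open>k + 1\<close> edges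
from both ends of the new path, the one from \<open>v\<close> would show that \<open>f\<close> is an edge at \<open>v\<close>, and the one from
\<open>hd xs\<close>, which consists of all edges of P2, would therefore end with \<open>f\<close>. Without \<open>f\<close> it would be a path
with \<open>k\<close> edges from \<open>hd xs\<close>, which was excluded.\<close>
lemma path_growth:
  assumes fin: "finite Q" and card: "card Q \<le> k" and xs: "path_in P xs" "xs \<noteq> []"
    and v: "v \<notin> set xs" "\<And>e. e \<in> Q \<Longrightarrow> v \<notin> e"
    and no_path: "\<And>ys. \<lbrakk>path_in Q ys; length ys = Suc k\<rbrakk> \<Longrightarrow> hd ys \<noteq> hd xs"
    and ys: "path_in (insert f Q) ys" "length ys = Suc (Suc k)" "hd ys = hd xs"
    and zs: "path_in (insert f Q) zs" "length zs = Suc (Suc k)" "hd zs = v"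
  shows False
proof -
  obtain z zs' where "zs = v # z # zs'" using zs(2,3) by (cases zs; cases "tl zs") auto
  then have "{v, z} \<in> insert f Q" using zs(1) by (simp add: path_in_def)
  then have f: "f = {v, z}" using v(2) by auto
  have d: "distinct ys" and sub: "path_edges ys \<subseteq> insert f Q" using ys(1) by (auto simp: path_in_def)
  have "card (insert f Q) \<le> Suc k" using card card_insert_le_m1[of "Suc k" Q f] by simp
  then have "path_edges ys = insert f Q"
    using card_seteq[of "insert f Q" "path_edges ys"] sub card_path_edges[OF d] ys(2) fin by simp
  then have "v \<in> set ys" using path_edges_subset[of f ys] f by auto
  moreover have "hd ys \<noteq> v" using ys(3) v(1) xs(2) by auto
  moreover have "w = z" if "{w, v} \<in> insert f Q" for w
    using that v(2) f by (auto simp: doubleton_eq_iff)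
  ultimately obtain as where as: "ys = as @ [v]" "as \<noteq> []" "v \<notin> set as"
    using path_in_pendant_last[OF ys(1)] by metis
  have "path_edges as \<subseteq> insert f Q" "f \<notin> path_edges as"
    using sub as path_edges_subset[of f as] f by (auto simp: path_edges_append)
  then have "path_in Q as" using d as by (auto simp: path_in_def)
  moreover have "length as = Suc k" "hd as = hd xs" using as ys(2,3) by auto
  ultimately show False using no_path by blast
qed

section \<open>The strategy in the cycle game\<close>

locale cycle_game = board_game E V "has_cycle l" for E :: "'a set set" and V and l +
  assumes l: "3 \<le> l"
begin

lemma has_cycleI:
  assumes "distinct xs" "xs \<noteq> []" "path_edges xs \<subseteq> F" "{last xs, hd xs} \<in> F" "length xs = l"
  shows "has_cycle l F"
  using assms by (auto simp: has_cycle_def cycle_in_def path_in_def)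

text \<open>P1 owns a path \<open>x0 x1 \<dots> z1\<close> with \<open>l - 2\<close> edges. Extending it from \<open>z1\<close> to new vertices \<open>y1\<close> and \<open>y2\<close> forces
\<open>{x0, y1}\<close> and \<open>{x0, y2}\<close>. If \<open>l = 3\<close>, then \<open>z1 y1 y2\<close> is completed to a triangle. Otherwise a new
neighbour \<open>v\<close> of \<open>x1\<close> takes over the role of \<open>x0\<close> and both \<open>{v, y1}\<close> and \<open>{v, y2}\<close> close a cycle.\<close>
lemma endgame:
  assumes pos: "position (3 + j) P Q" and card: "card Q + 2 \<le> l"
    and xs: "path_in P xs" "set xs \<subseteq> V" "length xs + 1 = l"
    and no_path: "\<And>ys. \<lbrakk>path_in Q ys; length ys + 1 = l\<rbrakk> \<Longrightarrow> hd ys \<noteq> hd xs"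
  shows "wins 4 P Q"
proof -
  obtain x0 rest where x0: "xs = x0 # rest" "rest \<noteq> []"
    using xs(3) l by (cases xs; cases "tl xs") auto
  define z1 where "z1 = last rest"
  have d: "distinct xs" and sub: "path_edges xs \<subseteq> P" using xs(1) by (auto simp: path_in_def)
  have z1: "last xs = z1" "z1 \<noteq> x0" "z1 \<in> V" "x0 \<in> V" "z1 \<in> set rest"
    using x0 d xs(2) by (auto simp: z1_def)
  have fin: "finite Q" using pos by (simp add: position_def)
  have fresh_xs: "v \<notin> set xs" if "\<And>e. e \<in> P \<Longrightarrow> v \<notin> e" for v
    using path_in_fresh[OF xs(1) _ that] xs(3) l by simp
  have no_path': "hd ys \<noteq> x0" if "path_in Q ys" "length ys + 1 = l" for ys
    using no_path[OF that] x0 by simp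
  have x0_Q: "x0 \<notin> Y" if "\<And>y. y \<in> Y \<Longrightarrow> y \<notin> set xs" for Y using that x0(1) by auto
  note no_cycle = no_cycle_through_pendants[OF l fin card no_path']
  obtain y1 where y1: "y1 \<in> V" "\<And>e. e \<in> P \<Longrightarrow> y1 \<notin> e" "\<And>e. e \<in> Q \<Longrightarrow> y1 \<notin> e"
    using position_fresh[OF pos] by blast
  have n1: "y1 \<notin> set xs" using fresh_xs[OF y1(2)] .
  then have n1': "y1 \<noteq> x0" "y1 \<noteq> z1" using x0 z1 by auto
  let ?P1 = "insert {z1, y1} P" and ?Q1 = "insert {x0, y1} Q"
  have cycle: "has_cycle l (insert {x0, y} (insert {z1, y} P'))" if "P \<subseteq> P'" "y \<notin> set xs" for y P'
  proof (rule has_cycleI[of "xs @ [y]"])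
    have "xs \<noteq> []" using x0 by simp
    then have "path_edges (xs @ [y]) = insert {z1, y} (path_edges xs)"
      using path_edges_append[of xs "[y]"] z1(1) by simp
    then show "path_edges (xs @ [y]) \<subseteq> insert {x0, y} (insert {z1, y} P')" using sub that(1) by auto
    show "{last (xs @ [y]), hd (xs @ [y])} \<in> insert {x0, y} (insert {z1, y} P')"
      using x0 by (simp add: edge_commute)
  qed (use that d xs(3) in simp_all)
  have "wins (Suc (Suc 2)) P Q"
  proof (rule wins_force[where e = "{z1, y1}" and g = "{x0, y1}"])
    show "position (Suc (2 + j)) P Q" using pos by (simp add: numeral_eq_Suc)
    show "{z1, y1} \<in> E" "{x0, y1} \<in> E" using edge_in_V z1 y1(1) n1' by auto
    show "{z1, y1} \<notin> P" "{x0, y1} \<notin> P" "{z1, y1} \<notin> Q" "{x0, y1} \<notin> Q" using y1 by blast+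
    show "{x0, y1} \<noteq> {z1, y1}" using z1(2) n1' by (auto simp: doubleton_eq_iff)
    show "has_cycle l (insert {x0, y1} ?P1)" using cycle[of P y1] n1 by simp
    show "\<not> has_cycle l (insert f Q)" for f using no_cycle[of "{}" f] by simp
    assume pos1: "position (2 + j) ?P1 ?Q1"
    obtain y2 where y2: "y2 \<in> V" "\<And>e. e \<in> ?P1 \<Longrightarrow> y2 \<notin> e" "\<And>e. e \<in> ?Q1 \<Longrightarrow> y2 \<notin> e"
      using position_fresh[OF pos1] by blast
    have n2: "y2 \<notin> set xs" using fresh_xs[of y2] y2(2) by blast
    have n12: "y2 \<noteq> y1" using y2(2)[of "{z1, y1}"] by blast
    have n2': "y2 \<noteq> x0" "y2 \<noteq> z1" using n2 x0 z1 by auto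
    let ?P2 = "insert {z1, y2} ?P1" and ?Q2 = "insert {x0, y2} ?Q1"
    show "wins (Suc 2) ?P1 ?Q1"
    proof (rule wins_force[where e = "{z1, y2}" and g = "{x0, y2}"])
      show "position (Suc (1 + j)) ?P1 ?Q1" using pos1 by (simp add: numeral_eq_Suc)
      show "{z1, y2} \<in> E" "{x0, y2} \<in> E" using edge_in_V z1 y2(1) n2' by auto
      show "{z1, y2} \<notin> ?P1" "{x0, y2} \<notin> ?P1" "{z1, y2} \<notin> ?Q1" "{x0, y2} \<notin> ?Q1" using y2(2,3) by blast+
      show "{x0, y2} \<noteq> {z1, y2}" using z1(2) n2' by (auto simp: doubleton_eq_iff)
      show "has_cycle l (insert {x0, y2} ?P2)" using cycle[of ?P1 y2] n2 by (simp add: subset_insertI)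
      show "\<not> has_cycle l (insert f ?Q1)" for f
        using no_cycle[of "{y1}" f] y1(3) n1' by auto
      assume pos2: "position (1 + j) ?P2 ?Q2"
      show "wins 2 ?P2 ?Q2"
      proof (cases "l = 3")
        case True
        then have "rest = [z1]" using x0 xs(3) by (cases rest) (auto simp: z1_def)
        show ?thesis
        proof (rule wins_finish[of "{y1, y2}"])
          show "{y1, y2} \<in> E" using edge_in_V y1(1) y2(1) n12 by auto
          show "{y1, y2} \<notin> ?P2" "{y1, y2} \<notin> ?Q2"
            using y2(2,3) n1' n12 by (auto simp: doubleton_eq_iff)
          show "has_cycle l (insert {y1, y2} ?P2)"
            by (rule has_cycleI[of "[z1, y1, y2]"]) (use True n1' n2' n12 in \<open>auto simp: edge_commute\<close>)
        qed simp
      next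
        case False
        have len: "2 \<le> length rest" using False l x0 xs(3) by auto
        obtain v where v: "v \<in> V" "\<And>e. e \<in> ?P2 \<Longrightarrow> v \<notin> e" "\<And>e. e \<in> ?Q2 \<Longrightarrow> v \<notin> e"
          using position_fresh[OF pos2] by blast
        have nv: "v \<notin> set xs" using fresh_xs[of v] v(2) by blast
        have nv': "v \<noteq> y1" "v \<noteq> y2" using v(2)[of "{z1, y1}"] v(2)[of "{z1, y2}"] by blast+
        define x1 where "x1 = hd rest"
        have x1: "x1 \<in> set rest" using x0(2) x1_def by simp
        then have nx1: "x1 \<in> V" "x1 \<noteq> v" "x1 \<noteq> x0" using xs(2) x0 nv d by auto
        have cycle': "has_cycle l (insert {v, y} (insert {x1, v} ?P2))"
          if "{z1, y} \<in> ?P2" "y \<notin> set xs" "y \<noteq> v" for y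
        proof (rule has_cycleI[of "v # rest @ [y]"])
          have "path_edges (v # rest @ [y]) = insert {v, x1} (path_edges (rest @ [y]))"
            using path_edges_append[of "[v]" "rest @ [y]"] x0(2) unfolding x1_def by simp
          also have "path_edges (rest @ [y]) = insert {z1, y} (path_edges rest)"
            using path_edges_append[of rest "[y]"] x0(2) unfolding z1_def by simp
          also have "{v, x1} = {x1, v}" by (rule edge_commute)
          finally have pe: "path_edges (v # rest @ [y]) = insert {x1, v} (insert {z1, y} (path_edges rest))" .
          have "path_edges xs = insert {x0, hd rest} (path_edges rest)"
            using path_edges_append[of "[x0]" rest] x0(2) unfolding x0(1) by simp
          then have "path_edges rest \<subseteq> ?P2" using sub by blast
          with that(1) show "path_edges (v # rest @ [y]) \<subseteq> insert {v, y} (insert {x1, v} ?P2)"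
            unfolding pe by blast
          show "distinct (v # rest @ [y])" using d nv that(2,3) unfolding x0(1) by auto
          show "length (v # rest @ [y]) = l" using x0 xs(3) by simp
        qed (auto simp: edge_commute)
        show ?thesis
        proof (rule wins_double_threat[where e = "{x1, v}" and g = "{v, y1}" and g' = "{v, y2}"])
          show "position (Suc j) ?P2 ?Q2" using pos2 by simp
          show "{x1, v} \<in> E" "{v, y1} \<in> E" "{v, y2} \<in> E"
            using edge_in_V v(1) y1(1) y2(1) nx1 nv' by auto
          show "{x1, v} \<notin> ?P2" "{x1, v} \<notin> ?Q2" "{v, y1} \<notin> ?P2" "{v, y1} \<notin> ?Q2"
            "{v, y2} \<notin> ?P2" "{v, y2} \<notin> ?Q2" using v(2,3) by blast+
          have "x1 \<noteq> y1" "x1 \<noteq> y2" using x1 n1 n2 x0 by auto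
          then show "{v, y1} \<noteq> {x1, v}" "{v, y2} \<noteq> {x1, v}" "{v, y1} \<noteq> {v, y2}"
            using n12 nv' by (auto simp: doubleton_eq_iff)
          show "has_cycle l (insert {v, y1} (insert {x1, v} ?P2))"
            using n1 nv' by (intro cycle') auto
          show "has_cycle l (insert {v, y2} (insert {x1, v} ?P2))"
            using n2 nv' by (intro cycle') auto
          show "\<not> has_cycle l (insert f ?Q2)" for f
          proof -
            have "?Q2 = Q \<union> (\<lambda>y. {x0, y}) ` {y1, y2}" by auto
            moreover have "y \<notin> e" if "e \<in> Q" "y \<in> {y1, y2}" for e y
              using that y1(3) y2(3) by blast
            ultimately show ?thesis using no_cycle[of "{y1, y2}" f] n1' n2' False by auto
          qed
        qed
      qed
    qed simp
  qed simp
  then show ?thesis by (simp add: eval_nat_numeral)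
qed

text \<open>P1 prolongs its path by new vertices, keeping the invariant that from one of its ends, listed first,
P2 has no path of the same length. By \<open>path_growth\<close> the invariant survives every reply, if the new
path is reversed where necessary.\<close>
lemma grow_path:
  assumes "position (i + 3) P Q" "card Q \<le> k" "path_in P xs" "set xs \<subseteq> V" "length xs = Suc k"
    and "\<And>ys. \<lbrakk>path_in Q ys; length ys = Suc k\<rbrakk> \<Longrightarrow> hd ys \<noteq> hd xs"
    and "0 < k" "k + i + 2 = l"
  shows "wins (i + 4) P Q"
  using assms
proof (induction i arbitrary: P Q k xs)
  case 0
  then show ?case using endgame[of 0 P Q xs] by simp
next
  case (Suc i)
  note pos = Suc.prems(1) and xs = Suc.prems(3-5)
  obtain v where v: "v \<in> V" "\<And>e. e \<in> P \<Longrightarrow> v \<notin> e" "\<And>e. e \<in> Q \<Longrightarrow> v \<notin> e"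
    using position_fresh[OF pos] by blast
  have fin: "finite Q" using pos by (simp add: position_def)
  have ne: "xs \<noteq> []" using xs(3) by auto
  have nv: "v \<notin> set xs"
    using path_in_fresh[OF xs(1) _ v(2)] xs(3) Suc.prems(7) by simp
  let ?e = "{last xs, v}"
  have lV: "last xs \<in> V" "last xs \<noteq> v" using xs(2) ne nv by auto
  have "wins (Suc (i + 4)) P Q"
  proof (rule wins_step[of "i + 3"])
    show "position (Suc (i + 3)) P Q" using pos by simp
    show "?e \<in> E" using edge_in_V lV v(1) by simp
    show "?e \<notin> P" "?e \<notin> Q" using v(2,3) by blast+
    fix f assume f: "f \<in> E" "f \<notin> P" "f \<notin> Q" "f \<noteq> ?e" and p: "position (i + 3) (insert ?e P) (insert f Q)"
    have card: "card (insert f Q) \<le> Suc k"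
      using Suc.prems(2) card_insert_le_m1[of "Suc k" Q f] by simp
    have new: "path_in (insert ?e P) (xs @ [v])" "set (xs @ [v]) \<subseteq> V" "length (xs @ [v]) = Suc (Suc k)"
      using xs ne nv v(1) by (auto simp: path_in_def path_edges_append)
    have rev: "path_in (insert ?e P) (rev (xs @ [v]))"
      using new(1) unfolding path_in_def by (simp add: path_edges_rev del: rev_append)
    have "wins (i + 4) (insert ?e P) (insert f Q)"
    proof (cases "\<exists>ys. path_in (insert f Q) ys \<and> length ys = Suc (Suc k) \<and> hd ys = hd xs")
      case False
      show ?thesis
        by (rule Suc.IH[OF p card new]) (use False ne Suc.prems(8) in auto)
    next
      case True
      then obtain ys where ys: "path_in (insert f Q) ys" "length ys = Suc (Suc k)" "hd ys = hd xs" by blast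
      have "hd zs \<noteq> v" if "path_in (insert f Q) zs" "length zs = Suc (Suc k)" for zs
        using path_growth[OF fin Suc.prems(2) xs(1) ne nv v(3) Suc.prems(6) ys that] by blast
      then show ?thesis
        by (intro Suc.IH[OF p card rev]) (use new Suc.prems(8) in auto)
    qed
    moreover have "\<not> has_cycle l (insert f Q)"
    proof
      assume "has_cycle l (insert f Q)"
      then have "l \<le> card (insert f Q)" using cycle_in_card[of "insert f Q"] l fin by (auto simp: has_cycle_def)
      then show False using card Suc.prems(8) by simp
    qed
    ultimately show "\<not> has_cycle l (insert f Q) \<and> wins (i + 4) (insert ?e P) (insert f Q)" by blast
  qed
  then show ?case by simp
qed

text \<open>P2's first edge misses one end of P1's first edge, which gives the invariant of \<open>grow_path\<close> for paths
with one edge.\<close>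
lemma wins_from_start:
  assumes "4 * l + 6 \<le> card V"
  shows "wins (l + 2) {} {}"
proof -
  have pos0: "position (Suc l) {} {}" using assms by (simp add: position_def)
  have "V \<noteq> {}" using assms by auto
  then obtain x where x: "x \<in> V" by blast
  obtain x' where x': "x' \<in> V" "x' \<noteq> x"
  proof -
    have "V \<noteq> {x}" using assms by auto
    with x that show thesis by blast
  qed
  have "wins (Suc (l - 3 + 4)) {} {}"
  proof (rule wins_step[OF pos0, of "{x, x'}"])
    show "{x, x'} \<in> E" using edge_in_V x x' by simp
    fix f assume f: "f \<in> E" "f \<noteq> {x, x'}" and p1: "position l {{x, x'}} {f}"
    have "card f = 2" using card_edge f by simp
    then have "\<not> {x, x'} \<subseteq> f" using f(2) x' card_seteq[of f "{x, x'}"] by (auto simp: card_2_iff)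
    then obtain u a where ua: "{x, x'} = {u, a}" "u \<notin> f" "u \<in> V" "a \<in> V" "u \<noteq> a"
      using x x' by (metis insert_commute insert_subset empty_subsetI)
    have "wins (l - 3 + 4) {{x, x'}} {f}"
    proof (rule grow_path[of _ _ _ 1 "[u, a]"])
      show "position (l - 3 + 3) {{x, x'}} {f}" using p1 l by simp
      show "path_in {{x, x'}} [u, a]" using ua by (simp add: path_in_def)
      fix ys assume "path_in {f} ys" "length ys = Suc 1"
      then show "hd ys \<noteq> hd [u, a]" using ua(2) by (cases ys; cases "tl ys") (auto simp: path_in_def)
    qed (use ua l in auto)
    moreover have "\<not> has_cycle l {f}"
      using cycle_in_card[of "{f}"] l by (auto simp: has_cycle_def)
    ultimately show "\<not> has_cycle l {f} \<and> wins (l - 3 + 4) {{x, x'}} {f}" by blast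
  qed simp_all
  moreover have "Suc (l - 3 + 4) = l + 2" using l by simp
  ultimately show ?thesis by metis
qed

end

section \<open>The target graphs as edge patterns\<close>

lemma has_target_iff_embedding:
  assumes H: "simple_graph H" and F: "\<And>e. e \<in> F \<Longrightarrow> card e = 2"
  shows "has_target B H F \<longleftrightarrow>
    (\<exists>g. inj_on g (verts H) \<and> g ` verts H \<subseteq> verts B \<and> (\<forall>e\<in>edges H. g ` e \<in> F))"
proof
  assume "has_target B H F"
  then obtain G f where G: "simple_graph G" "verts G \<subseteq> verts B" "edges G \<subseteq> F"
    and f: "bij_betw f (verts G) (verts H)" "(`) f ` edges G = edges H"
    by (auto simp: has_target_def subgraph_def isomorphic_def)
  define g where "g = inv_into (verts G) f"
  have "bij_betw g (verts H) (verts G)" unfolding g_def by (rule bij_betw_inv_into[OF f(1)])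
  moreover have "g ` e \<in> F" if "e \<in> edges H" for e
  proof -
    obtain e' where e': "e' \<in> edges G" "e = f ` e'" using \<open>e \<in> edges H\<close> f(2) by blast
    then have "e' \<subseteq> verts G" using G(1) by (simp add: simple_graph_def)
    then have "g ` e = e'"
      unfolding e'(2) g_def using bij_betw_imp_inj_on[OF f(1)] by (simp add: inv_into_image_cancel)
    then show ?thesis using e'(1) G(3) by auto
  qed
  ultimately show "\<exists>g. inj_on g (verts H) \<and> g ` verts H \<subseteq> verts B \<and> (\<forall>e\<in>edges H. g ` e \<in> F)"
    using G(2) by (intro exI[of _ g]) (auto simp: bij_betw_def)
next
  assume "\<exists>g. inj_on g (verts H) \<and> g ` verts H \<subseteq> verts B \<and> (\<forall>e\<in>edges H. g ` e \<in> F)"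
  then obtain g where g: "inj_on g (verts H)" "g ` verts H \<subseteq> verts B" "\<And>e. e \<in> edges H \<Longrightarrow> g ` e \<in> F"
    by blast
  define G where "G = \<lparr>verts = g ` verts H, edges = (`) g ` edges H\<rparr>"
  have sub: "e \<subseteq> verts H" if "e \<in> edges H" for e using H that by (simp add: simple_graph_def)
  have "subgraph G \<lparr>verts = verts B, edges = F\<rparr>"
    using g F sub by (fastforce simp: subgraph_def simple_graph_def G_def)
  moreover have "isomorphic G H"
    unfolding isomorphic_def
  proof (intro exI conjI)
    show "bij_betw (inv_into (verts H) g) (verts G) (verts H)"
      unfolding G_def using g(1) by (simp add: bij_betw_inv_into inj_on_imp_bij_betw)
    have "inv_into (verts H) g ` g ` e = e" if "e \<in> edges H" for e
      using inv_into_image_cancel[OF g(1) sub[OF that]] .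
    then show "(`) (inv_into (verts H) g) ` edges G = edges H"
      unfolding G_def by (simp add: image_image)
  qed
  ultimately show "has_target B H F" unfolding has_target_def by blast
qed

lemma simple_complete_bipartite: "simple_graph (complete_bipartite m n)"
  by (auto simp: simple_graph_def complete_bipartite_def card_insert_if)

lemma simple_cycle_graph: "3 \<le> l \<Longrightarrow> simple_graph (cycle_graph l)"
  by (auto simp: simple_graph_def cycle_graph_def card_insert_if mod_Suc)

lemma has_target_k23_iff:
  assumes "simple_graph B" "F \<subseteq> edges B"
  shows "has_target B (complete_bipartite 2 3) F \<longleftrightarrow> k23 F"
proof -
  have F: "card e = 2" "e \<subseteq> verts B" if "e \<in> F" for e
    using assms that by (auto simp: simple_graph_def)
  let ?H = "complete_bipartite 2 3"
  have less: "{..<2} = {0, 1::nat}" "{..<3} = {0, 1, 2::nat}" by auto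
  have vH: "verts ?H = {Inl 0, Inl 1, Inr 0, Inr 1, Inr 2}"
    unfolding complete_bipartite_def by (simp add: less insert_commute)
  have "edges ?H = (\<Union>i\<in>{..<2}. \<Union>j\<in>{..<3}. {{Inl i, Inr j}})"
    by (auto simp: complete_bipartite_def)
  then have eH: "(\<forall>e\<in>edges ?H. g ` e \<in> F) \<longleftrightarrow>
    {g (Inl 0), g (Inr 0)} \<in> F \<and> {g (Inl 0), g (Inr 1)} \<in> F \<and> {g (Inl 0), g (Inr 2)} \<in> F \<and>
    {g (Inl 1), g (Inr 0)} \<in> F \<and> {g (Inl 1), g (Inr 1)} \<in> F \<and> {g (Inl 1), g (Inr 2)} \<in> F" for g
    unfolding less by auto
  have embed: "has_target B ?H F \<longleftrightarrow>
    (\<exists>g. inj_on g (verts ?H) \<and> g ` verts ?H \<subseteq> verts B \<and> (\<forall>e\<in>edges ?H. g ` e \<in> F))"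
    by (rule has_target_iff_embedding[OF simple_complete_bipartite F(1)])
  show ?thesis
  proof
    assume "has_target B ?H F"
    then obtain g where g: "inj_on g (verts ?H)" "\<forall>e\<in>edges ?H. g ` e \<in> F"
      unfolding embed by blast
    show "k23 F"
      by (rule k23_I[of "g (Inl 0)" "g (Inl 1)" "g (Inr 0)" "g (Inr 1)" "g (Inr 2)"])
        (use g(1) g(2)[unfolded eH] in \<open>auto simp: vH inj_on_def\<close>)
  next
    assume "k23 F"
    then obtain u v a b c where d: "distinct [u, v, a, b, c]"
      and e: "{u, a} \<in> F" "{u, b} \<in> F" "{u, c} \<in> F" "{v, a} \<in> F" "{v, b} \<in> F" "{v, c} \<in> F"
      by (rule k23_E)
    define g where "g = case_sum (\<lambda>i::nat. if i = 0 then u else v) (\<lambda>i::nat. if i = 0 then a else if i = 1 then b else c)"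
    have "g ` verts ?H \<subseteq> verts B" using F(2)[OF e(1)] F(2)[OF e(2)] F(2)[OF e(3)] F(2)[OF e(4)]
      by (simp add: vH g_def)
    moreover have "inj_on g (verts ?H)" using d by (auto simp: vH g_def)
    moreover have "\<forall>e\<in>edges ?H. g ` e \<in> F" using e by (simp add: eH g_def)
    ultimately show "has_target B ?H F" unfolding embed by blast
  qed
qed

lemma cycle_in_iff_nth:
  assumes "xs \<noteq> []"
  shows "cycle_in F xs \<longleftrightarrow> distinct xs \<and> (\<forall>i<length xs. {xs ! i, xs ! (Suc i mod length xs)} \<in> F)"
proof -
  have "(\<forall>i<length xs. {xs ! i, xs ! (Suc i mod length xs)} \<in> F) \<longleftrightarrow>
    (\<forall>i. Suc i < length xs \<longrightarrow> {xs ! i, xs ! Suc i} \<in> F) \<and> {last xs, hd xs} \<in> F" (is "?L \<longleftrightarrow> ?R")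
  proof
    assume L: ?L
    have "{xs ! i, xs ! Suc i} \<in> F" if "Suc i < length xs" for i
      using L[rule_format, of i] that by simp
    moreover have "{last xs, hd xs} \<in> F"
      using L[rule_format, of "length xs - 1"] assms by (simp add: last_conv_nth hd_conv_nth)
    ultimately show ?R by blast
  next
    assume R: ?R
    show ?L
    proof (intro allI impI)
      fix i assume "i < length xs"
      then consider "Suc i < length xs" | "Suc i = length xs" by linarith
      then show "{xs ! i, xs ! (Suc i mod length xs)} \<in> F"
      proof cases
        case 2
        then have "i = length xs - 1" by simp
        then show ?thesis using R 2 assms by (simp add: last_conv_nth hd_conv_nth)
      qed (use R in simp)
    qed
  qed
  then show ?thesis using assms by (auto simp: cycle_in_def path_in_def path_edges_nth)
qed

lemma has_target_cycle_iff:
  assumes "simple_graph B" "F \<subseteq> edges B" "3 \<le> l"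
  shows "has_target B (cycle_graph l) F \<longleftrightarrow> has_cycle l F"
proof -
  have F: "card e = 2" "e \<subseteq> verts B" if "e \<in> F" for e
    using assms that by (auto simp: simple_graph_def)
  have embed: "has_target B (cycle_graph l) F \<longleftrightarrow> (\<exists>g. inj_on g (verts (cycle_graph l)) \<and>
    g ` verts (cycle_graph l) \<subseteq> verts B \<and> (\<forall>e\<in>edges (cycle_graph l). g ` e \<in> F))"
    by (rule has_target_iff_embedding[OF simple_cycle_graph[OF assms(3)] F(1)])
  have verts: "verts (cycle_graph l) = {..<l}" by (simp add: cycle_graph_def)
  have "edges (cycle_graph l) = (\<lambda>i. {i, Suc i mod l}) ` {..<l}" by (auto simp: cycle_graph_def)
  then have edges: "(\<forall>e\<in>edges (cycle_graph l). g ` e \<in> F) \<longleftrightarrow> (\<forall>i<l. {g i, g (Suc i mod l)} \<in> F)"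
    for g :: "nat \<Rightarrow> 'a" by auto
  show ?thesis
  proof
    assume "has_target B (cycle_graph l) F"
    then obtain g where g: "inj_on g {..<l}" "\<And>i. i < l \<Longrightarrow> {g i, g (Suc i mod l)} \<in> F"
      unfolding embed verts edges by blast
    have "cycle_in F (map g [0..<l])"
      using g assms(3) by (subst cycle_in_iff_nth) (auto simp: distinct_map atLeast0LessThan)
    then show "has_cycle l F" unfolding has_cycle_def by (intro exI[of _ "map g [0..<l]"]) simp
  next
    assume "has_cycle l F"
    then obtain xs where xs: "length xs = l" "cycle_in F xs" by (auto simp: has_cycle_def)
    then have "xs \<noteq> []" by (auto simp: cycle_in_def)
    from xs(2) have c: "distinct xs" "\<And>i. i < l \<Longrightarrow> {xs ! i, xs ! (Suc i mod l)} \<in> F"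
      unfolding cycle_in_iff_nth[OF \<open>xs \<noteq> []\<close>] xs(1) by auto
    have "inj_on ((!) xs) {..<l}" using c(1) xs(1) by (auto simp: inj_on_def nth_eq_iff_index_eq)
    moreover have "(!) xs ` {..<l} \<subseteq> verts B" using F(2)[OF c(2)] by auto
    ultimately show "has_target B (cycle_graph l) F"
      unfolding embed verts edges using c(2) by blast
  qed
qed

lemma simple_complete_graph: "simple_graph (complete_graph n)"
  by (auto simp: simple_graph_def complete_graph_def)

lemma simple_disjoint_union:
  assumes "simple_graph G" "simple_graph H"
  shows "simple_graph (disjoint_union G H)"
proof -
  have "card ((Inl :: 'a \<Rightarrow> 'a + 'b) ` e) = card e" "card ((Inr :: 'b \<Rightarrow> 'a + 'b) ` e') = card e'" for e e'
    by (simp_all add: card_image)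
  moreover have "Inl ` e \<subseteq> Inl ` verts G" if "e \<in> edges G" for e
    using assms(1) that by (auto simp: simple_graph_def)
  moreover have "Inr ` e \<subseteq> Inr ` verts H" if "e \<in> edges H" for e
    using assms(2) that by (auto simp: simple_graph_def)
  ultimately show ?thesis using assms unfolding simple_graph_def disjoint_union_def by fastforce
qed

section \<open>The two games\<close>

lemma board_complete_graph: "board (edges (complete_graph n)) {..<n}"
  by unfold_locales (auto simp: complete_graph_def card_insert_if)

lemma board_disjoint_union:
  "board (edges (disjoint_union (complete_graph n) (complete_graph n))) (Inl ` {..<n})"
proof
  let ?E = "edges (disjoint_union (complete_graph n) (complete_graph n))"
  have s: "simple_graph (disjoint_union (complete_graph n) (complete_graph n))"
    by (intro simple_disjoint_union simple_complete_graph)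
  then show "card e = 2" if "e \<in> ?E" for e using that by (simp add: simple_graph_def)
  show "{x, y} \<in> ?E" if xy: "x \<in> Inl ` {..<n}" "y \<in> Inl ` {..<n}" "x \<noteq> y" for x y :: "nat + nat"
  proof -
    obtain i j where "x = Inl i" "y = Inl j" "i < n" "j < n" using xy by auto
    then have e: "{i, j} \<in> edges (complete_graph n)" and "{x, y} = Inl ` {i, j}"
      using xy(3) by (auto simp: complete_graph_def card_insert_if)
    then have "{x, y} \<in> (`) Inl ` edges (complete_graph n)" by blast
    then show ?thesis by (simp add: disjoint_union_def)
  qed
  show "y \<in> Inl ` {..<n}" if xy: "{x, y} \<in> ?E" "x \<in> Inl ` {..<n}" for x y :: "nat + nat"
  proof -
    obtain i where "x = Inl i" using xy(2) by auto
    moreover from this have "{x, y} \<notin> (`) Inr ` edges (complete_graph n)" by auto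
    ultimately have "{x, y} \<in> (`) Inl ` edges (complete_graph n)" using xy(1) by (simp add: disjoint_union_def)
    then obtain e where "{x, y} = Inl ` e" "e \<subseteq> {..<n}" by (auto simp: complete_graph_def)
    then show ?thesis by blast
  qed
qed

lemma P1_wins_cycle:
  assumes "3 \<le> l" "4 * l + 6 \<le> n"
  shows "P1_wins_within (l + 2) (complete_graph n) (cycle_graph l)"
proof -
  interpret cycle_game "edges (complete_graph n)" "{..<n}" l
    by (intro cycle_game.intro board_game.intro board_complete_graph cycle_game_axioms.intro assms(1))
  have "forced_win (edges (complete_graph n)) (has_target (complete_graph n) (cycle_graph l)) (l + 2) {} {}"
    using wins_from_start assms
    by (subst forced_win_cong[OF has_target_cycle_iff[OF simple_complete_graph]]) auto
  then show ?thesis by (rule P1_wins_within_if_forced_win)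
qed

lemma P1_wins_k23:
  assumes "42 \<le> n"
  shows "P1_wins_within 11 (disjoint_union (complete_graph n) (complete_graph n)) (complete_bipartite 2 3)"
proof -
  let ?B = "disjoint_union (complete_graph n) (complete_graph n)"
  interpret k23_game "edges ?B" "Inl ` {..<n}"
    by (intro k23_game.intro board_game.intro board_disjoint_union)
  have "card (Inl ` {..<n} :: (nat + nat) set) = n" by (simp add: card_image)
  then have k23: "forced_win (edges ?B) k23 11 {} {}" using wins_from_start assms by simp
  have "simple_graph ?B" by (intro simple_disjoint_union simple_complete_graph)
  then have "forced_win (edges ?B) (has_target ?B (complete_bipartite 2 3)) 11 {} {} =
    forced_win (edges ?B) k23 11 {} {}"
    by (intro forced_win_cong has_target_k23_iff empty_subsetI)
  with k23 have "forced_win (edges ?B) (has_target ?B (complete_bipartite 2 3)) 11 {} {}" by metis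
  then show ?thesis by (rule P1_wins_within_if_forced_win)
qed

theorem theorem1p4:
  shows "(\<exists>c n0. \<forall>n\<ge>n0.
            P1_wins_within c (disjoint_union (complete_graph n) (complete_graph n))
              (complete_bipartite 2 3)) \<and>
         (\<forall>l\<ge>3. \<exists>c n0. \<forall>n\<ge>n0. P1_wins_within c (complete_graph n) (cycle_graph l))"
proof (intro conjI allI impI)
  show "\<exists>c n0. \<forall>n\<ge>n0. P1_wins_within c (disjoint_union (complete_graph n) (complete_graph n))
      (complete_bipartite 2 3)"
    using P1_wins_k23 by (intro exI[of _ 11] exI[of _ 42]) simp
  fix l :: nat assume "3 \<le> l"
  then show "\<exists>c n0. \<forall>n\<ge>n0. P1_wins_within c (complete_graph n) (cycle_graph l)"
    using P1_wins_cycle by (intro exI[of _ "l + 2"] exI[of _ "4 * l + 6"]) simp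
qed

end
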